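(* For every positive integer $n$, the simplicial complexes $X(\mathbb{Z}^n)$ and $K(\mathbb{Z}^n)$ are Cohen-Macaulay; that is, for each simplex $\sigma$ of the complex, all reduced homology groups of the link of $\sigma$ vanish except possibly in the top degree (the dimension of the link).
   Context: A set $\{v_1,\ldots,v_m\}$ of elements of $\mathbb{Z}^n$ is called unimodular if $\operatorname{span}\{v_1,\ldots,v_m\}$ is a direct summand of $\mathbb{Z}^n$ of rank $m$. The simplicial complex $X(\mathbb{Z}^n)$ has as vertices the $v\in\mathbb{Z}^n$ with $\{v\}$ unimodular, and as simplices all unimodular subsets of $\mathbb{Z}^n$. A line in $\mathbb{Z}^n$ is a submodule of rank $1$ that is a direct summand of $\mathbb{Z}^n$. The simplicial complex $K(\mathbb{Z}^n)$ has as vertices all lines in $\mathbb{Z}^n$; its $m$-simplices are the sets of $m+1$ lines which span a direct summand of rank $m+1$. The link of $\sigma$ in $K$ is $\mathrm{Lk}_K(\sigma)=\{\tau : \sigma\cup\tau\in K,\ \sigma\cap\tau=\emptyset\}$. The empty simplex is allowed, with link the whole complex; the link of a maximal simplex is $\{\emptyset\}$, of dimension $-1$. A finite-dimensional, possibly infinite simplicial complex is called Cohen-Macaulay if, for every simplex $\sigma$, the reduced homology groups (with coefficients in $\mathbb{Z}$) of the link of $\sigma$ are trivial except in top degree. *)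

theory Defs
  imports
    "HOL-Analysis.Finite_Cartesian_Product"
    "HOL-Algebra.Elementary_Groups"
    "HOL-Combinatorics.Permutations"
begin

section \<open>Abstract simplicial complexes and their reduced homology\<close>

text \<open>A complex is given by its set of simplices. The empty simplex always belongs to it.\<close>

definition simplicial_complex :: "'v set set \<Rightarrow> bool" where
  "simplicial_complex K \<longleftrightarrow>
     {} \<in> K \<and> (\<forall>\<sigma>\<in>K. finite \<sigma> \<and> (\<forall>\<tau>. \<tau> \<subseteq> \<sigma> \<longrightarrow> \<tau> \<in> K))"

definition finite_dimensional_complex :: "'v set set \<Rightarrow> bool" where
  "finite_dimensional_complex K \<longleftrightarrow> (\<exists>d. \<forall>\<sigma>\<in>K. card \<sigma> \<le> d)"

text \<open>Only meaningful for finite-dimensional complexes. The complex \<open>{{}}\<close> has dimension -1.\<close>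

definition complex_dim :: "'v set set \<Rightarrow> int" where
  "complex_dim K = Max ((\<lambda>\<sigma>. int (card \<sigma>) - 1) ` K)"

definition link :: "'v set set \<Rightarrow> 'v set \<Rightarrow> 'v set set" where
  "link K \<sigma> = {\<tau>. \<sigma> \<union> \<tau> \<in> K \<and> \<sigma> \<inter> \<tau> = {}}"

text \<open>
  Oriented integral simplicial chains. A list of \<open>p + 1\<close> distinct vertices spanning a simplex is a
  \<open>p\<close>-simplex together with an ordering of its vertices. A \<open>p\<close>-chain is a finitely supported
  integer-valued function on these lists that changes by the sign of a permutation of the vertices,
  that is, a function on oriented simplices that changes sign when the orientation is reversed.
  The empty list makes the group of (-1)-chains infinite cyclic, so this is the augmented chain
  complex.
\<close>

definition chain_group :: "int \<Rightarrow> 'v set set \<Rightarrow> ('v list \<Rightarrow> int) monoid" where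
  "chain_group p K =
     \<lparr>carrier = {c. finite {xs. c xs \<noteq> 0} \<and>
                    (\<forall>xs. c xs \<noteq> 0 \<longrightarrow> distinct xs \<and> set xs \<in> K \<and> int (length xs) = p + 1) \<and>
                    (\<forall>xs \<pi>. \<pi> permutes {..<length xs} \<longrightarrow> c (permute_list \<pi> xs) = sign \<pi> * c xs)},
      monoid.mult = (\<lambda>c d xs. c xs + d xs),
      monoid.one = (\<lambda>xs. 0)\<rparr>"

text \<open>
  The usual boundary, sending an oriented simplex \<open>[v\<^sub>0, \<dots>, v\<^sub>p]\<close> to the sum of its faces
  \<open>[v\<^sub>0, \<dots>, v\<^sub>p]\<close> without \<open>v\<^sub>i\<close>, with signs \<open>(-1) ^ i\<close>, expressed through values of
  chains: up to the sign \<open>(-1) ^ i\<close>, the list \<open>[v\<^sub>0, \<dots>, v\<^sub>p]\<close> is the \<open>i\<close>-th face with \<open>v\<^sub>i\<close>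
  put in front of it. For \<open>p = 0\<close> this is the augmentation.
\<close>

definition boundary :: "('v list \<Rightarrow> int) \<Rightarrow> 'v list \<Rightarrow> int" where
  "boundary c xs = (\<Sum>v | c (v # xs) \<noteq> 0. c (v # xs))"

definition reduced_homology :: "int \<Rightarrow> 'v set set \<Rightarrow> ('v list \<Rightarrow> int) set monoid" where
  "reduced_homology p K =
     subgroup_generated (chain_group p K) (kernel (chain_group p K) (chain_group (p - 1) K) boundary)
       Mod (boundary ` carrier (chain_group (p + 1) K))"

definition cohen_macaulay :: "'v set set \<Rightarrow> bool" where
  "cohen_macaulay K \<longleftrightarrow>
     simplicial_complex K \<and> finite_dimensional_complex K \<and>
     (\<forall>\<sigma>\<in>K. \<forall>p. p \<noteq> complex_dim (link K \<sigma>) \<longrightarrow> trivial_group (reduced_homology p (link K \<sigma>)))"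


section \<open>Unimodular sets and lines\<close>

global_interpretation int_vec: Modules.module "(*s) :: int \<Rightarrow> int ^ 'n \<Rightarrow> int ^ 'n"
  by unfold_locales (simp_all add: vec_eq_iff algebra_simps)

definition direct_summand :: "(int ^ 'n) set \<Rightarrow> bool" where
  "direct_summand A \<longleftrightarrow>
     int_vec.subspace A \<and>
     (\<exists>B. int_vec.subspace B \<and> A \<inter> B = {0} \<and> {a + b | a b. a \<in> A \<and> b \<in> B} = UNIV)"

text \<open>
  The rank of a submodule is the largest size of a linearly independent subset. These sizes are
  bounded by \<open>CARD('n)\<close>, so the maximum exists.
\<close>

definition rank :: "(int ^ 'n) set \<Rightarrow> nat" where
  "rank A = Max {card B | B. finite B \<and> B \<subseteq> A \<and> int_vec.independent B}"

definition unimodular :: "(int ^ 'n) set \<Rightarrow> bool" where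
  "unimodular S \<longleftrightarrow>
     finite S \<and> direct_summand (int_vec.span S) \<and> rank (int_vec.span S) = card S"

definition X_complex :: "(int ^ 'n) set set" where
  "X_complex = {S. unimodular S}"

definition line :: "(int ^ 'n) set \<Rightarrow> bool" where
  "line L \<longleftrightarrow> direct_summand L \<and> rank L = 1"

definition K_complex :: "(int ^ 'n) set set set" where
  "K_complex =
     {S. finite S \<and> (\<forall>L\<in>S. line L) \<and>
         direct_summand (int_vec.span (\<Union>S)) \<and> rank (int_vec.span (\<Union>S)) = card S}"

end

theory Submission
  imports Defs "HOL-Analysis.Cartesian_Space"
begin

text \<open>
  The simplices of these complexes have at most \<open>n\<close> vertices, so the link of a simplex \<open>\<sigma>\<close> has
  dimension at most \<open>n - card \<sigma> - 1\<close>. It therefore suffices that its reduced homology vanishes up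
  to degree \<open>n - card \<sigma> - 2\<close> (\<open>cohen_macaulayI\<close>).

  For vectors this is proved by induction on the corank \<open>n - card S\<close> of the unimodular set \<open>S\<close>
  (\<open>acyclic_link_X\<close>). If the corank is positive, \<open>S\<close> extends by a vector \<open>e\<close>, and there is an integer
  functional \<open>g\<close> with \<open>g e = 1\<close> that vanishes on \<open>S\<close> (\<open>unimodular_extend\<close>). Its absolute value is a
  height on the vertices of the link of \<open>S\<close>. Every simplex of height \<open>0\<close> spans a simplex with \<open>e\<close>, so
  cycles of height \<open>0\<close> bound. A cycle of larger height is pushed down: let \<open>w\<close> be one of
  its vertices of maximal height \<open>R\<close>. The coefficient of \<open>w\<close> in the cycle is a cycle in the link of
  \<open>insert w S\<close> using only vertices below \<open>R\<close> and finitely many of height \<open>R\<close>. If it bounds among the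
  same vertices, then \<open>w\<close> can be removed from the original cycle (\<open>cycles_bound_insert_vertex\<close>).

  It bounds for the following reason. Let \<open>T\<close> be a unimodular set that contains \<open>w\<close>. Division with
  remainder by \<open>g w\<close> replaces every vertex \<open>v\<close> of the link of \<open>T\<close> by some \<open>v - q w\<close> of height
  below \<open>R\<close>. Such shears preserve unimodularity (\<open>unimodular_shear\<close>), so the part of the link below
  \<open>R\<close> is a retract of the link of \<open>T\<close>, which is acyclic in the required range by the induction
  hypothesis (\<open>acyclic_link_below\<close>). The vertices of height \<open>R\<close> are then put back one at a time
  (\<open>acyclic_link_below_Un\<close>).

  The linear algebra is kept elementary by describing a unimodular set as a finite set with a
  dual system of integer functionals (\<open>unimodular_iff\<close>). Finally, every line is generated by a
  primitive vector that is unique up to sign. A choice of generators makes the links in the complex of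
  lines retracts of links in the complex of vectors (\<open>acyclic_link_K\<close>).
\<close>

section \<open>Alternating functions on lists\<close>

text \<open>
  Adjacent transpositions generate the symmetric group, so sign changes under them already
  give the behaviour under all permutations. For lists this form needs no index arithmetic.
\<close>

definition alternating :: "('v list \<Rightarrow> int) \<Rightarrow> bool" where
  "alternating c \<longleftrightarrow> (\<forall>as x y bs. c (as @ x # y # bs) = - c (as @ y # x # bs))"

lemma alternatingD: "alternating c \<Longrightarrow> c (as @ x # y # bs) = - c (as @ y # x # bs)"
  unfolding alternating_def by blast

lemma alternating_add: "alternating c \<Longrightarrow> alternating d \<Longrightarrow> alternating (\<lambda>xs. c xs + d xs)"
  unfolding alternating_def by (metis add.inverse_distrib_swap add.commute)

lemma alternating_uminus: "alternating c \<Longrightarrow> alternating (\<lambda>xs. - c xs)"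
  unfolding alternating_def by metis

lemma alternating_Cons: "alternating c \<Longrightarrow> alternating (\<lambda>xs. c (v # xs))"
  unfolding alternating_def by (metis append_Cons)

lemma alternating_move:
  assumes "alternating c" and "bs = bs' @ bs''"
  shows "c (as @ x # bs) = (-1) ^ length bs' * c (as @ bs' @ x # bs'')"
  using assms(2)
proof (induction bs' arbitrary: as bs)
  case (Cons b bs')
  have "c (as @ x # bs) = - c ((as @ [b]) @ x # bs' @ bs'')"
    using alternatingD[OF assms(1), of as x b "bs' @ bs''"] Cons.prems by simp
  also have "\<dots> = - ((-1) ^ length bs' * c ((as @ [b]) @ bs' @ x # bs''))"
    using Cons.IH[of "bs' @ bs''" "as @ [b]"] by simp
  finally show ?case by simp
qed simp

text \<open>
  Move the left entry across the middle, exchange two neighbours, and move the other entry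
  back: the two moves contribute the same sign, the exchange contributes \<open>-1\<close>.
\<close>

lemma alternating_swap:
  assumes "alternating c"
  shows "c (as @ x # ms @ y # bs) = - c (as @ y # ms @ x # bs)"
proof -
  have "c (as @ x # ms @ y # bs) = (-1) ^ length ms * c ((as @ ms) @ x # y # bs)"
    using alternating_move[OF assms, of "ms @ y # bs" ms "y # bs" as x] by simp
  also have "c ((as @ ms) @ x # y # bs) = - c ((as @ ms) @ y # x # bs)"
    by (rule alternatingD[OF assms])
  also have "(-1) ^ length ms * - c ((as @ ms) @ y # x # bs) = - c (as @ y # ms @ x # bs)"
    using alternating_move[OF assms, of "ms @ x # bs" ms "x # bs" as y] by simp
  finally show ?thesis .
qed

lemma permute_list_transpose:
  assumes "i < length xs" "j < length xs"
  shows "permute_list (Transposition.transpose i j) xs = xs[i := xs ! j, j := xs ! i]"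
  using assms
  by (intro nth_equalityI) (auto simp: permute_list_def nth_list_update Transposition.transpose_def)

lemma alternating_transpose:
  assumes c: "alternating c" and ij: "i < length xs" "j < length xs" "i \<noteq> j"
  shows "c (permute_list (Transposition.transpose i j) xs) = - c xs"
proof -
  have "c (permute_list (Transposition.transpose i j) xs) = - c xs" if "i < j" "j < length xs" for i j
  proof -
    define as x ms y bs where "as = take i xs" and "x = xs ! i" and "ms = take (j - i - 1) (drop (i + 1) xs)"
      and "y = xs ! j" and "bs = drop (j + 1) xs"
    note defs = this
    have "drop (Suc i) xs = ms @ drop (j - i - 1) (drop (i + 1) xs)"
      unfolding defs by (simp del: drop_drop)
    also have "drop (j - i - 1) (drop (i + 1) xs) = y # bs"
      using that Cons_nth_drop_Suc[of j xs] by (simp add: defs)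
    finally have xs: "xs = as @ x # ms @ y # bs"
      using that id_take_nth_drop[of i xs] by (simp add: defs)
    have len: "i = length as" "j = length as + Suc (length ms)"
      using that by (auto simp: defs)
    have "xs[i := y, j := x] = as @ y # ms @ x # bs"
      unfolding len by (simp add: xs list_update_append)
    then show ?thesis
      using that alternating_swap[OF c, of as y ms x bs]
      by (simp add: permute_list_transpose xs[symmetric] flip: defs)
  qed
  then show ?thesis
    using ij by (metis linorder_neqE_nat transpose_commute)
qed

lemma alternating_iff_sign:
  fixes c :: "'a list \<Rightarrow> int"
  shows "alternating c \<longleftrightarrow> (\<forall>xs \<pi>. \<pi> permutes {..<length xs} \<longrightarrow> c (permute_list \<pi> xs) = sign \<pi> * c xs)"
proof
  assume c: "alternating c"
  show "\<forall>xs \<pi>. \<pi> permutes {..<length xs} \<longrightarrow> c (permute_list \<pi> xs) = sign \<pi> * c xs"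
  proof (intro allI impI)
    fix xs :: "'a list" and \<pi> :: "nat \<Rightarrow> nat"
    assume "\<pi> permutes {..<length xs}"
    then have "\<forall>ys. length ys = length xs \<longrightarrow> c (permute_list \<pi> ys) = sign \<pi> * c ys"
      using finite_lessThan
    proof (induction \<pi> rule: permutes_induct)
      case (swap a b p)
      have "sign (Transposition.transpose a b \<circ> p) = - sign p"
        using swap by (subst sign_compose) (auto simp: sign_swap_id intro: permutation_swap_id permutes_imp_permutation)
      moreover have "c (permute_list (Transposition.transpose a b \<circ> p) ys)
          = sign p * - c ys" if "length ys = length xs" for ys
        using swap that alternating_transpose[OF c, of a ys b] by (simp add: permute_list_compose del: o_apply)
      ultimately show ?case by (simp del: o_apply)
    qed simp_all
    then show "c (permute_list \<pi> xs) = sign \<pi> * c xs" by simp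
  qed
next
  assume *: "\<forall>xs \<pi>. \<pi> permutes {..<length xs} \<longrightarrow> c (permute_list \<pi> xs) = sign \<pi> * c xs"
  show "alternating c"
    unfolding alternating_def
  proof (intro allI)
    fix as bs :: "'a list" and x y
    let ?xs = "as @ y # x # bs" and ?t = "Transposition.transpose (length as) (Suc (length as))"
    have "?t permutes {..<length ?xs}"
      by (rule permutes_swap_id) auto
    then have "c (permute_list ?t ?xs) = sign ?t * c ?xs"
      using * by blast
    moreover have "permute_list ?t ?xs = as @ x # y # bs"
      by (subst permute_list_transpose) (auto simp: nth_append list_update_append)
    ultimately show "c (as @ x # y # bs) = - c (as @ y # x # bs)"
      by (simp add: sign_swap_id)
  qed
qed

section \<open>Chains and their boundary\<close>

definition chain :: "int \<Rightarrow> 'v set set \<Rightarrow> ('v list \<Rightarrow> int) \<Rightarrow> bool" where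
  "chain p K c \<longleftrightarrow> finite {xs. c xs \<noteq> 0} \<and>
     (\<forall>xs. c xs \<noteq> 0 \<longrightarrow> distinct xs \<and> set xs \<in> K \<and> int (length xs) = p + 1) \<and> alternating c"

lemma carrier_chain_group: "carrier (chain_group p K) = Collect (chain p K)"
  by (auto simp: chain_group_def chain_def alternating_iff_sign)

lemma chain_finite: "chain p K c \<Longrightarrow> finite {xs. c xs \<noteq> 0}"
  by (simp add: chain_def)

lemma chain_support:
  assumes "chain p K c" "c xs \<noteq> 0"
  shows "distinct xs" "set xs \<in> K" "int (length xs) = p + 1"
  using assms by (auto simp: chain_def)

lemma chain_alternating: "chain p K c \<Longrightarrow> alternating c"
  by (simp add: chain_def)

lemma chain_mono: "chain p K c \<Longrightarrow> (\<And>xs. c xs \<noteq> 0 \<Longrightarrow> set xs \<in> L) \<Longrightarrow> chain p L c"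
  by (auto simp: chain_def)

lemma chain_zero [simp]: "chain p K (\<lambda>xs. 0)"
  by (simp add: chain_def alternating_def)

lemma chain_uminus: "chain p K c \<Longrightarrow> chain p K (\<lambda>xs. - c xs)"
  by (simp add: chain_def alternating_uminus)

lemma chain_add:
  assumes "chain p K c" "chain p K d"
  shows "chain p K (\<lambda>xs. c xs + d xs)"
proof -
  have "finite {xs. c xs + d xs \<noteq> 0}"
    by (rule finite_subset[of _ "{xs. c xs \<noteq> 0} \<union> {xs. d xs \<noteq> 0}"])
      (use assms in \<open>auto simp: chain_def\<close>)
  moreover have "distinct xs \<and> set xs \<in> K \<and> int (length xs) = p + 1" if "c xs + d xs \<noteq> 0" for xs
  proof -
    have "c xs \<noteq> 0 \<or> d xs \<noteq> 0" using that by auto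
    then show ?thesis using assms unfolding chain_def by blast
  qed
  ultimately show ?thesis
    using assms unfolding chain_def by (blast intro: alternating_add)
qed

lemma boundary_eq_sum:
  assumes "finite A" "\<And>v. c (v # xs) \<noteq> 0 \<Longrightarrow> v \<in> A"
  shows "boundary c xs = (\<Sum>v\<in>A. c (v # xs))"
  unfolding boundary_def by (rule sum.mono_neutral_left) (use assms in auto)

text \<open>
  The boundary sums over a support that depends on the chain and the list. Summing over all
  vertices of the chain instead makes the boundary visibly linear.
\<close>

definition chain_vertices :: "('v list \<Rightarrow> int) \<Rightarrow> 'v set" where
  "chain_vertices c = \<Union> (set ` {xs. c xs \<noteq> 0})"

lemma finite_chain_vertices: "chain p K c \<Longrightarrow> finite (chain_vertices c)"
  by (simp add: chain_vertices_def chain_finite)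

lemma chain_vertices_memI: "c xs \<noteq> 0 \<Longrightarrow> v \<in> set xs \<Longrightarrow> v \<in> chain_vertices c"
  by (auto simp: chain_vertices_def)

lemma boundary_chain_eq:
  assumes "chain p K c" "finite A" "chain_vertices c \<subseteq> A"
  shows "boundary c xs = (\<Sum>v\<in>A. c (v # xs))"
proof (rule boundary_eq_sum[OF assms(2)])
  show "v \<in> A" if "c (v # xs) \<noteq> 0" for v
    using assms(3) chain_vertices_memI[of c, OF that, of v] by auto
qed

lemma boundary_zero: "boundary (\<lambda>xs. 0) = (\<lambda>xs. 0)"
  by (simp add: boundary_def fun_eq_iff)

lemma boundary_add:
  assumes "chain p K c" "chain q L d"
  shows "boundary (\<lambda>xs. c xs + d xs) xs = boundary c xs + boundary d xs"
proof -
  let ?A = "chain_vertices c \<union> chain_vertices d"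
  have A: "finite ?A" using assms by (simp add: finite_chain_vertices)
  have "boundary (\<lambda>xs. c xs + d xs) xs = (\<Sum>v\<in>?A. c (v # xs) + d (v # xs))"
  proof (rule boundary_eq_sum[OF A])
    fix v assume "c (v # xs) + d (v # xs) \<noteq> 0"
    then have "c (v # xs) \<noteq> 0 \<or> d (v # xs) \<noteq> 0" by auto
    then show "v \<in> ?A" using chain_vertices_memI[of _ "v # xs" v] by auto
  qed
  then show ?thesis
    using boundary_chain_eq[OF assms(1) A] boundary_chain_eq[OF assms(2) A]
    by (simp add: sum.distrib)
qed

lemma boundary_uminus: "boundary (\<lambda>xs. - c xs) xs = - boundary c xs"
  by (simp add: boundary_def sum_negf)

lemma boundary_nonzero:
  assumes "boundary c xs \<noteq> 0" obtains v where "c (v # xs) \<noteq> 0"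
proof -
  have "\<exists>v. c (v # xs) \<noteq> 0"
  proof (rule ccontr)
    assume "\<not> ?thesis"
    then show False using assms by (simp add: boundary_def)
  qed
  then show ?thesis using that by blast
qed

lemma chain_boundary:
  assumes K: "simplicial_complex K" and c: "chain p K c"
  shows "chain (p - 1) K (boundary c)"
  unfolding chain_def
proof (intro conjI allI impI)
  have "{xs. boundary c xs \<noteq> 0} \<subseteq> tl ` {xs. c xs \<noteq> 0}"
    by (force elim: boundary_nonzero)
  then show "finite {xs. boundary c xs \<noteq> 0}"
    using chain_finite[OF c] finite_surj by blast
next
  fix xs assume "boundary c xs \<noteq> 0"
  then obtain v where v: "c (v # xs) \<noteq> 0" by (rule boundary_nonzero)
  note * = chain_support[OF c v]
  have "set xs \<subseteq> set (v # xs)" by auto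
  then show "set xs \<in> K" using *(2) K unfolding simplicial_complex_def by blast
  show "distinct xs" "int (length xs) = p - 1 + 1" using * by auto
next
  show "alternating (boundary c)"
    unfolding alternating_def boundary_chain_eq[OF c finite_chain_vertices[OF c] order_refl] sum_negf[symmetric]
    by (intro allI sum.cong refl alternatingD alternating_Cons chain_alternating[OF c])
qed

text \<open>
  Exchanging the two vertices that are removed maps the double sum to its negative.
\<close>

lemma boundary_boundary:
  assumes K: "simplicial_complex K" and c: "chain p K c"
  shows "boundary (boundary c) xs = 0"
proof -
  let ?A = "chain_vertices c"
  note A = finite_chain_vertices[OF c]
  have "boundary (boundary c) xs = (\<Sum>v\<in>?A. boundary c (v # xs))"
    by (rule boundary_eq_sum[OF A]) (auto elim!: boundary_nonzero intro: chain_vertices_memI)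
  also have "\<dots> = (\<Sum>v\<in>?A. \<Sum>u\<in>?A. c (u # v # xs))"
    by (simp add: boundary_chain_eq[OF c A])
  finally have 1: "boundary (boundary c) xs = (\<Sum>v\<in>?A. \<Sum>u\<in>?A. c (u # v # xs))" .
  also have "\<dots> = (\<Sum>v\<in>?A. \<Sum>u\<in>?A. - c (v # u # xs))"
    by (intro sum.cong refl alternatingD[OF chain_alternating[OF c], of "[]", simplified])
  also have "\<dots> = - (\<Sum>v\<in>?A. \<Sum>u\<in>?A. c (v # u # xs))"
    by (simp add: sum_negf)
  also have "(\<Sum>v\<in>?A. \<Sum>u\<in>?A. c (v # u # xs)) = boundary (boundary c) xs"
    unfolding 1 by (rule sum.swap)
  finally show ?thesis by simp
qed

section \<open>Cones\<close>

text \<open>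
  The cone \<open>w * y\<close>: on lists that start with \<open>w\<close> it is \<open>y\<close> of the rest, and the other values are
  the ones forced by alternation when \<open>w\<close> is moved to the front.
\<close>

fun cone :: "'v \<Rightarrow> ('v list \<Rightarrow> int) \<Rightarrow> 'v list \<Rightarrow> int" where
  "cone w y [] = 0"
| "cone w y (x # xs) = (if x = w then y xs else - cone w (\<lambda>ys. y (x # ys)) xs)"

lemma cone_notin: "w \<notin> set xs \<Longrightarrow> cone w y xs = 0"
  by (induction xs arbitrary: y) auto

lemma cone_at: "w \<notin> set as \<Longrightarrow> cone w y (as @ w # bs) = (-1) ^ length as * y (as @ bs)"
  by (induction as arbitrary: y) auto

lemma cone_nonzero:
  assumes "cone w y xs \<noteq> 0"
  obtains as bs where "xs = as @ w # bs" "w \<notin> set as" "y (as @ bs) \<noteq> 0"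
proof -
  have "w \<in> set xs" using assms cone_notin by metis
  then obtain as bs where xs: "xs = as @ w # bs" "w \<notin> set as" by (meson split_list_first)
  then show ?thesis using that assms by (simp add: cone_at)
qed

lemma cone_uminus: "cone w (\<lambda>ys. - y ys) xs = - cone w y xs"
  by (induction xs arbitrary: y) auto

text \<open>
  If both exchanged vertices are \<open>w\<close>, the two sides are values of \<open>y\<close> on lists that still contain
  \<open>w\<close>; this is where \<open>y\<close> has to vanish.
\<close>

lemma cone_swap:
  assumes "alternating y" "\<And>xs. w \<in> set xs \<Longrightarrow> y xs = 0"
  shows "cone w y (as @ a # b # bs) = - cone w y (as @ b # a # bs)"
  using assms
proof (induction as arbitrary: y)
  case Nil
  have "(\<lambda>ys. y (a # b # ys)) = (\<lambda>ys. - y (b # a # ys))"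
    by (rule ext) (rule alternatingD[OF Nil(1), of "[]", simplified])
  then show ?case using Nil(2) by (simp add: cone_uminus)
next
  case (Cons x as)
  have "cone w (\<lambda>ys. y (x # ys)) (as @ a # b # bs) = - cone w (\<lambda>ys. y (x # ys)) (as @ b # a # bs)"
    using Cons.prems by (intro Cons.IH alternating_Cons) auto
  then show ?case
    using alternatingD[OF Cons.prems(1), of as a b bs] by simp
qed

lemma chain_cone:
  assumes y: "chain p L y" and L: "\<And>\<sigma>. \<sigma> \<in> L \<Longrightarrow> w \<notin> \<sigma> \<and> insert w \<sigma> \<in> K"
  shows "chain (p + 1) K (cone w y)"
  unfolding chain_def
proof (intro conjI allI impI)
  have "xs \<in> (\<Union>ys\<in>{ys. y ys \<noteq> 0}. (\<lambda>k. take k ys @ w # drop k ys) ` {..length ys})"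
    if xs: "cone w y xs \<noteq> 0" for xs
  proof -
    obtain as bs where *: "xs = as @ w # bs" "w \<notin> set as" "y (as @ bs) \<noteq> 0"
      using xs by (rule cone_nonzero)
    then have "xs = take (length as) (as @ bs) @ w # drop (length as) (as @ bs)" by simp
    then show ?thesis using *(3) by (intro UN_I[of "as @ bs"] image_eqI[of _ _ "length as"]) auto
  qed
  then show "finite {xs. cone w y xs \<noteq> 0}"
    by (intro finite_subset[of "{xs. cone w y xs \<noteq> 0}"
        "\<Union>ys\<in>{ys. y ys \<noteq> 0}. (\<lambda>k. take k ys @ w # drop k ys) ` {..length ys}"])
      (use chain_finite[OF y] in auto)
next
  fix xs assume "cone w y xs \<noteq> 0"
  then obtain as bs where *: "xs = as @ w # bs" "w \<notin> set as" "y (as @ bs) \<noteq> 0"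
    by (rule cone_nonzero)
  note s = chain_support[OF y *(3)]
  have "set xs = insert w (set (as @ bs))" using * by auto
  then show "set xs \<in> K" "distinct xs" "int (length xs) = p + 1 + 1"
    using L[OF s(2)] s * by auto
next
  have "y xs = 0" if "w \<in> set xs" for xs
    using chain_support(2)[OF y, of xs] L that by blast
  then show "alternating (cone w y)"
    unfolding alternating_def using cone_swap[OF chain_alternating[OF y]] by blast
qed

text \<open>
  The formula \<open>\<partial>(w * y) = y - w * \<partial>y\<close>. On a list without \<open>w\<close> only the face opposite to \<open>w\<close> counts;
  on a list with \<open>w\<close> every summand has the sign that moves \<open>w\<close> past one more vertex.
\<close>

lemma boundary_cone:
  assumes y: "chain p L y" and L: "\<And>\<sigma>. \<sigma> \<in> L \<Longrightarrow> w \<notin> \<sigma>"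
  shows "boundary (cone w y) xs = y xs - cone w (boundary y) xs"
proof (cases "w \<in> set xs")
  case False
  have "boundary (cone w y) xs = (\<Sum>v\<in>{w}. cone w y (v # xs))"
    by (rule boundary_eq_sum) (use False in \<open>auto simp: cone_notin split: if_splits\<close>)
  then show ?thesis using False by (simp add: cone_notin)
next
  case True
  then obtain as bs where xs: "xs = as @ w # bs" "w \<notin> set as" by (meson split_list_first)
  have y0: "y xs = 0" if "w \<in> set xs" for xs
    using chain_support(2)[OF y, of xs] L that by blast
  have *: "cone w y (v # xs) = - ((-1) ^ length as * y (v # as @ bs))" for v
    using xs y0 cone_at[of w as "\<lambda>ys. y (v # ys)" bs] by simp
  let ?A = "chain_vertices y"
  note A = finite_chain_vertices[OF y]
  have "boundary (cone w y) xs = (\<Sum>v\<in>?A. cone w y (v # xs))"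
    by (rule boundary_eq_sum[OF A], unfold *) (auto intro: chain_vertices_memI)
  also have "\<dots> = - ((-1) ^ length as * boundary y (as @ bs))"
    unfolding * by (simp add: boundary_chain_eq[OF y A] sum_negf sum_distrib_left)
  also have "\<dots> = - cone w (boundary y) xs"
    using xs by (simp add: cone_at)
  finally show ?thesis using y0[OF True] by simp
qed

section \<open>Cycles that bound\<close>

text \<open>
  For a subcomplex \<open>K\<close> of \<open>L\<close> this says that the inclusion is zero on reduced homology up to degree
  \<open>d\<close>. The version with two complexes is needed because the intermediate subcomplexes in the
  induction for a link need not be acyclic themselves.
\<close>

definition cycles_bound :: "int \<Rightarrow> 'v set set \<Rightarrow> 'v set set \<Rightarrow> bool" where
  "cycles_bound d K L \<longleftrightarrow> (\<forall>p\<le>d. \<forall>z. chain p K z \<and> boundary z = (\<lambda>xs. 0) \<longrightarrow>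
     (\<exists>b. chain (p + 1) L b \<and> boundary b = z))"

abbreviation acyclic_upto :: "int \<Rightarrow> 'v set set \<Rightarrow> bool" where
  "acyclic_upto d K \<equiv> cycles_bound d K K"

lemma cycles_bound_mono:
  "cycles_bound d K L \<Longrightarrow> L \<subseteq> M \<Longrightarrow> cycles_bound d K M"
  unfolding cycles_bound_def by (meson chain_mono chain_support(2) subsetD)

definition full_subcomplex :: "'v set set \<Rightarrow> 'v set \<Rightarrow> 'v set set" where
  "full_subcomplex K V = {\<sigma> \<in> K. \<sigma> \<subseteq> V}"

lemma simplicial_complex_full_subcomplex:
  "simplicial_complex K \<Longrightarrow> simplicial_complex (full_subcomplex K V)"
  by (auto simp: simplicial_complex_def full_subcomplex_def)

lemma simplicial_complex_link:
  "simplicial_complex K \<Longrightarrow> \<sigma> \<in> K \<Longrightarrow> simplicial_complex (link K \<sigma>)"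
  unfolding simplicial_complex_def link_def
  by (auto; meson Un_mono order_refl subset_iff)

lemma cycles_bound_cone:
  assumes "\<And>\<sigma>. \<sigma> \<in> K \<Longrightarrow> w \<notin> \<sigma> \<and> insert w \<sigma> \<in> L"
  shows "cycles_bound d K L"
  unfolding cycles_bound_def
proof (intro allI impI, elim conjE)
  fix p z assume z: "chain p K z" "boundary z = (\<lambda>xs. 0)"
  have "cone w (\<lambda>xs. 0) xs = 0" for xs
    using cone_uminus[of w "\<lambda>xs. 0" xs] by simp
  then have "boundary (cone w z) = z"
    using boundary_cone[OF z(1), of w] assms by (auto simp: z(2))
  then show "\<exists>b. chain (p + 1) L b \<and> boundary b = z"
    using chain_cone[OF z(1) assms] by blast
qed

text \<open>
  A cycle \<open>z\<close> of the larger complex has the form \<open>w * y + z\<^sub>0\<close> with \<open>w\<close> not in \<open>z\<^sub>0\<close>, and \<open>y\<close> is a cycle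
  in the link of \<open>w\<close>. If \<open>y = \<partial>b\<close> in the link, adding \<open>\<partial>(w * b) = b - w * y\<close> pushes \<open>z\<close> off \<open>w\<close>
  without changing its homology class. This replaces a Mayer-Vietoris sequence.
\<close>

lemma cycles_bound_insert_vertex:
  assumes K: "simplicial_complex K" and KL: "full_subcomplex K (insert w V) \<subseteq> L"
    and L: "cycles_bound d (full_subcomplex K V) L"
    and link: "{w} \<in> K \<Longrightarrow> acyclic_upto (d - 1) (full_subcomplex (link K {w}) V)"
    and w: "w \<notin> V"
  shows "cycles_bound d (full_subcomplex K (insert w V)) L"
  unfolding cycles_bound_def
proof (intro allI impI, elim conjE)
  fix p z assume p: "p \<le> d" and z: "chain p (full_subcomplex K (insert w V)) z"
    and bz: "boundary z = (\<lambda>xs. 0)"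
  let ?K' = "full_subcomplex K (insert w V)" and ?Lk = "full_subcomplex (link K {w}) V"
  have sK': "simplicial_complex ?K'"
    by (rule simplicial_complex_full_subcomplex[OF K])
  \<comment> \<open>The coefficient of \<open>w\<close> in \<open>z\<close>.\<close>
  define y where "y = (\<lambda>xs. z (w # xs))"
  have y: "chain (p - 1) ?Lk y"
    unfolding chain_def
  proof (intro conjI allI impI)
    have "{xs. y xs \<noteq> 0} \<subseteq> tl ` {xs. z xs \<noteq> 0}"
      by (force simp: y_def)
    then show "finite {xs. y xs \<noteq> 0}"
      using chain_finite[OF z] finite_surj by blast
  next
    fix xs assume "y xs \<noteq> 0"
    then show "distinct xs" "set xs \<in> ?Lk" "int (length xs) = p - 1 + 1"
      using chain_support[OF z, of "w # xs"] by (auto simp: y_def full_subcomplex_def link_def)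
  next
    show "alternating y"
      unfolding y_def by (rule alternating_Cons[OF chain_alternating[OF z]])
  qed
  have by_: "boundary y = (\<lambda>xs. 0)"
  proof
    fix xs
    have "boundary y xs = (\<Sum>v\<in>chain_vertices z. z (w # v # xs))"
      unfolding y_def
      by (rule boundary_eq_sum) (auto intro: chain_vertices_memI finite_chain_vertices[OF z])
    also have "\<dots> = (\<Sum>v\<in>chain_vertices z. - z (v # w # xs))"
      by (intro sum.cong refl alternatingD[OF chain_alternating[OF z], of "[]", simplified])
    also have "\<dots> = - boundary z (w # xs)"
      by (simp add: boundary_chain_eq[OF z finite_chain_vertices[OF z]] sum_negf)
    finally show "boundary y xs = 0" by (simp add: bz)
  qed
  obtain b where b: "chain p ?Lk b" "boundary b = y"
  proof (cases "{w} \<in> K")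
    case True
    have "\<exists>b. chain (p - 1 + 1) ?Lk b \<and> boundary b = y"
      using link[OF True] p y by_ unfolding cycles_bound_def by (metis diff_right_mono)
    then show ?thesis using that by auto
  next
    case False
    \<comment> \<open>Then no simplex of \<open>z\<close> contains \<open>w\<close>.\<close>
    have "y xs = 0" for xs
    proof (rule ccontr)
      assume "y xs \<noteq> 0"
      then have "insert w (set xs) \<in> K"
        using chain_support(2)[OF z, of "w # xs"] by (simp add: y_def full_subcomplex_def)
      then show False using K False unfolding simplicial_complex_def
        by (meson empty_subsetI insert_subset insertI1)
    qed
    then show ?thesis using that[of "\<lambda>xs. 0"] by (simp add: boundary_zero fun_eq_iff)
  qed
  have Lk: "w \<notin> \<sigma> \<and> insert w \<sigma> \<in> ?K'" if "\<sigma> \<in> ?Lk" for \<sigma>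
    using that by (auto simp: full_subcomplex_def link_def)
  have cb: "chain (p + 1) ?K' (cone w b)"
    by (rule chain_cone[OF b(1) Lk])
  define z' where "z' = (\<lambda>xs. z xs + boundary (cone w b) xs)"
  have z'K: "chain p ?K' z'"
    unfolding z'_def using chain_add[OF z] chain_boundary[OF sK' cb] by simp
  \<comment> \<open>On lists with \<open>w\<close> the chains \<open>z\<close> and \<open>w * y\<close> agree by alternation.\<close>
  have z'w: "z' xs = 0" if w: "w \<in> set xs" for xs
  proof -
    obtain as bs where xs: "xs = as @ w # bs" "w \<notin> set as" using w by (meson split_list_first)
    have "b xs = 0" using chain_support(2)[OF b(1), of xs] Lk w by blast
    then have "boundary (cone w b) xs = - cone w y xs"
      using boundary_cone[OF b(1), of w xs] Lk b(2) by auto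
    moreover have "cone w y xs = z xs"
      using alternating_move[OF chain_alternating[OF z], of "as @ bs" as bs "[]" w] xs
      by (simp add: cone_at y_def)
    ultimately show ?thesis by (simp add: z'_def)
  qed
  have z': "chain p (full_subcomplex K V) z'"
  proof (rule chain_mono[OF z'K])
    fix xs assume xs: "z' xs \<noteq> 0"
    then show "set xs \<in> full_subcomplex K V"
      using chain_support(2)[OF z'K xs] z'w[of xs] by (auto simp: full_subcomplex_def)
  qed
  have "boundary z' = (\<lambda>xs. 0)"
    unfolding z'_def
    by (rule ext, subst boundary_add[OF z chain_boundary[OF sK' cb]])
      (simp add: bz boundary_boundary[OF sK' cb])
  then obtain u where u: "chain (p + 1) L u" "boundary u = z'"
    using L p z' unfolding cycles_bound_def by blast
  have mb: "chain (p + 1) L (\<lambda>xs. - cone w b xs)"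
    by (rule chain_uminus, rule chain_mono[OF cb]) (use KL chain_support(2)[OF cb] in auto)
  have "boundary (\<lambda>xs. u xs + - cone w b xs) = z"
    by (rule ext, subst boundary_add[OF u(1) mb]) (simp add: u(2) boundary_uminus z'_def)
  then show "\<exists>b. chain (p + 1) L b \<and> boundary b = z"
    using chain_add[OF u(1) mb] by blast
qed

section \<open>Chains under simplicial maps\<close>

text \<open>
  Only maps that are injective on each simplex are needed. For them the induced map of chains has
  no degenerate simplices to discard.
\<close>

definition simplicial_embedding :: "('a \<Rightarrow> 'b) \<Rightarrow> 'a set set \<Rightarrow> 'b set set \<Rightarrow> bool" where
  "simplicial_embedding f K L \<longleftrightarrow> (\<forall>\<sigma>\<in>K. inj_on f \<sigma> \<and> f ` \<sigma> \<in> L)"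

text \<open>
  The induced map of chains.
\<close>

definition push_chain :: "('a \<Rightarrow> 'b) \<Rightarrow> ('a list \<Rightarrow> int) \<Rightarrow> 'b list \<Rightarrow> int" where
  "push_chain f c ys = (\<Sum>xs | c xs \<noteq> 0 \<and> map f xs = ys. c xs)"

lemma push_chain_eq_sum:
  assumes "finite A" "\<And>xs. c xs \<noteq> 0 \<Longrightarrow> map f xs = ys \<Longrightarrow> xs \<in> A" "\<And>xs. xs \<in> A \<Longrightarrow> map f xs = ys"
  shows "push_chain f c ys = (\<Sum>xs\<in>A. c xs)"
  unfolding push_chain_def by (rule sum.mono_neutral_left) (use assms in auto)

lemma push_chain_nonzero:
  assumes "push_chain f c ys \<noteq> 0" obtains xs where "c xs \<noteq> 0" "map f xs = ys"
proof -
  have "\<exists>xs. c xs \<noteq> 0 \<and> map f xs = ys"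
    using assms sum.neutral unfolding push_chain_def by (metis (mono_tags, lifting) mem_Collect_eq)
  then show ?thesis using that by blast
qed

lemma chain_push:
  assumes f: "simplicial_embedding f K L" and c: "chain p K c"
  shows "chain p L (push_chain f c)"
  unfolding chain_def
proof (intro conjI allI impI)
  have "{ys. push_chain f c ys \<noteq> 0} \<subseteq> map f ` {xs. c xs \<noteq> 0}"
    by (auto elim!: push_chain_nonzero)
  then show "finite {ys. push_chain f c ys \<noteq> 0}"
    using chain_finite[OF c] finite_surj by blast
next
  fix ys assume "push_chain f c ys \<noteq> 0"
  then obtain xs where "c xs \<noteq> 0" "map f xs = ys" by (rule push_chain_nonzero)
  with chain_support[OF c] f show "distinct ys" "set ys \<in> L" "int (length ys) = p + 1"
    by (auto simp: simplicial_embedding_def distinct_map)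
next
  show "alternating (push_chain f c)"
    unfolding alternating_def
  proof (intro allI)
    fix as bs :: "'b list" and x y
    \<comment> \<open>Exchanging the entries at the positions of \<open>x\<close> and \<open>y\<close> is a bijection between the two sets of
    preimages, and changes the sign of \<open>c\<close>.\<close>
    define sw :: "'a list \<Rightarrow> 'a list" where
      "sw = (\<lambda>xs. take (length as) xs @ xs ! Suc (length as) # xs ! length as # drop (length as + 2) xs)"
    define A where "A = (\<lambda>x y. {xs. c xs \<noteq> 0 \<and> map f xs = as @ x # y # bs})"
    have split: "\<exists>as' x' y' bs'. xs = as' @ x' # y' # bs' \<and> length as' = length as
        \<and> map f as' = as \<and> f x' = x \<and> f y' = y \<and> map f bs' = bs"
      if xs: "map f xs = as @ x # y # bs" for xs x y
    proof -
      obtain as' zs where "xs = as' @ zs" "map f as' = as" "map f zs = x # y # bs"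
        using xs by (auto simp: map_eq_append_conv)
      moreover from this obtain x' y' bs' where "zs = x' # y' # bs'" "f x' = x" "f y' = y" "map f bs' = bs"
        by (auto simp: map_eq_Cons_conv)
      ultimately show ?thesis by (intro exI[of _ as'] exI[of _ x'] exI[of _ y'] exI[of _ bs']) auto
    qed
    have sw: "sw xs \<in> A y x \<and> sw (sw xs) = xs \<and> c (sw xs) = - c xs" if xs: "xs \<in> A x y" for xs x y
    proof -
      obtain as' x' y' bs' where *: "xs = as' @ x' # y' # bs'" "length as' = length as"
        "map f as' = as" "f x' = x" "f y' = y" "map f bs' = bs"
        using split xs unfolding A_def by blast
      then have "sw xs = as' @ y' # x' # bs'" "sw (sw xs) = xs"
        by (auto simp: sw_def nth_append)
      then show ?thesis
        using * xs alternatingD[OF chain_alternating[OF c], of as' y' x' bs'] by (auto simp: A_def)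
    qed
    have "(\<Sum>xs\<in>A x y. c xs) = (\<Sum>xs\<in>A y x. - c xs)"
      by (rule sum.reindex_bij_witness[of _ sw sw]) (use sw in auto)
    then show "push_chain f c (as @ x # y # bs) = - push_chain f c (as @ y # x # bs)"
      by (simp add: push_chain_def A_def sum_negf)
  qed
qed

lemma boundary_push:
  assumes c: "chain p K c"
  shows "boundary (push_chain f c) ys = push_chain f (boundary c) ys"
proof -
  let ?V = "chain_vertices c"
  note V = finite_chain_vertices[OF c]
  define T where "T = tl ` {xs. c xs \<noteq> 0}"
  have T: "finite T" unfolding T_def using chain_finite[OF c] by simp
  define S where "S = {xs \<in> T. map f xs = ys}"
  have S: "finite S" using T by (simp add: S_def)
  have T_I: "xs \<in> T" if "c (v # xs) \<noteq> 0" for v xs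
    using that unfolding T_def by force
  have 1: "push_chain f c (u # ys) = (\<Sum>(v, xs)\<in>{v \<in> ?V. f v = u} \<times> S. c (v # xs))" for u
  proof -
    have "push_chain f c (u # ys) = (\<Sum>xs\<in>(\<lambda>(v, xs). v # xs) ` ({v \<in> ?V. f v = u} \<times> S). c xs)"
    proof (rule push_chain_eq_sum)
      fix xs assume xs: "c xs \<noteq> 0" "map f xs = u # ys"
      then obtain v vs where "xs = v # vs" "f v = u" "map f vs = ys" by (auto simp: map_eq_Cons_conv)
      with xs show "xs \<in> (\<lambda>(v, xs). v # xs) ` ({v \<in> ?V. f v = u} \<times> S)"
        using chain_vertices_memI[of c xs v] T_I[of v vs] by (auto simp: S_def)
    qed (use V S in \<open>auto simp: S_def\<close>)
    also have "\<dots> = (\<Sum>(v, xs)\<in>{v \<in> ?V. f v = u} \<times> S. c (v # xs))"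
      by (subst sum.reindex) (auto simp: inj_on_def case_prod_unfold)
    finally show ?thesis .
  qed
  have "boundary (push_chain f c) ys = (\<Sum>u\<in>f ` ?V. push_chain f c (u # ys))"
    by (rule boundary_eq_sum)
      (use V in \<open>auto elim!: push_chain_nonzero simp: map_eq_Cons_conv intro!: imageI chain_vertices_memI\<close>)
  also have "\<dots> = (\<Sum>u\<in>f ` ?V. \<Sum>v\<in>{v \<in> ?V. f v = u}. \<Sum>xs\<in>S. c (v # xs))"
    by (simp add: 1 sum.cartesian_product)
  also have "\<dots> = (\<Sum>v\<in>?V. \<Sum>xs\<in>S. c (v # xs))"
    by (rule sum.image_gen[OF V, symmetric])
  also have "\<dots> = (\<Sum>xs\<in>S. boundary c xs)"
    by (subst sum.swap) (simp add: boundary_chain_eq[OF c V])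
  also have "\<dots> = push_chain f (boundary c) ys"
    by (rule push_chain_eq_sum[symmetric]) (use S T_I in \<open>auto simp: S_def elim!: boundary_nonzero\<close>)
  finally show ?thesis .
qed

lemma push_chain_section:
  assumes c: "chain p K c" and rs: "\<And>v. v \<in> \<Union>K \<Longrightarrow> r (s v) = v"
  shows "push_chain r (push_chain s c) = c"
proof
  fix xs
  have id: "map r (map s ys) = ys" if "c ys \<noteq> 0" for ys
  proof -
    have "r (s v) = v" if "v \<in> set ys" for v
      by (rule rs) (use that chain_support(2)[OF c \<open>c ys \<noteq> 0\<close>] in blast)
    then show ?thesis by (simp add: map_idI)
  qed
  have 0: "push_chain s c ys = c xs" if "ys = map s xs" "c xs \<noteq> 0" for xs ys
  proof -
    have "push_chain s c ys = (\<Sum>xs\<in>{xs}. c xs)"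
    proof (rule push_chain_eq_sum)
      show "zs \<in> {xs}" if "c zs \<noteq> 0" "map s zs = ys" for zs
        using id[of zs] id[of xs] that \<open>ys = map s xs\<close> \<open>c xs \<noteq> 0\<close> by simp
    qed (use that in auto)
    then show ?thesis by simp
  qed
  show "push_chain r (push_chain s c) xs = c xs"
  proof (cases "c xs = 0")
    case False
    have "push_chain r (push_chain s c) xs = (\<Sum>ys\<in>{map s xs}. push_chain s c ys)"
      by (rule push_chain_eq_sum) (use id False in \<open>auto elim!: push_chain_nonzero\<close>)
    then show ?thesis using 0 False by simp
  next
    case True
    show ?thesis
    proof (rule ccontr)
      assume "push_chain r (push_chain s c) xs \<noteq> c xs"
      then have "push_chain r (push_chain s c) xs \<noteq> 0" using True by simp
      then show False using id True by (metis push_chain_nonzero)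
    qed
  qed
qed

text \<open>
  Push a cycle of \<open>K\<close> into \<open>L\<close>, bound it there, and push the bounding chain back.
\<close>

lemma acyclic_upto_retract:
  assumes L: "acyclic_upto d L"
    and s: "simplicial_embedding s K L" and r: "simplicial_embedding r L K"
    and rs: "\<And>v. v \<in> \<Union>K \<Longrightarrow> r (s v) = v"
  shows "acyclic_upto d K"
  unfolding cycles_bound_def
proof (intro allI impI, elim conjE)
  fix p z assume p: "p \<le> d" and z: "chain p K z" "boundary z = (\<lambda>xs. 0)"
  have "boundary (push_chain s z) = (\<lambda>xs. 0)"
    by (rule ext) (simp add: boundary_push[OF z(1)] z(2) push_chain_def)
  then obtain b where b: "chain (p + 1) L b" "boundary b = push_chain s z"
    using L p chain_push[OF s z(1)] unfolding cycles_bound_def by blast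
  have "push_chain r (push_chain s z) = z"
    by (rule push_chain_section[OF z(1)]) (rule rs)
  then have "boundary (push_chain r b) = z"
    by (intro ext) (simp add: boundary_push[OF b(1)] b(2))
  then show "\<exists>b. chain (p + 1) K b \<and> boundary b = z"
    using chain_push[OF r b(1)] by blast
qed

section \<open>Vanishing of reduced homology\<close>

lemma comm_group_chain_group: "comm_group (chain_group p K)"
proof (rule comm_groupI)
  fix c assume "c \<in> carrier (chain_group p K)"
  then have "chain p K c" by (simp add: carrier_chain_group)
  then show "\<exists>y\<in>carrier (chain_group p K). y \<otimes>\<^bsub>chain_group p K\<^esub> c = \<one>\<^bsub>chain_group p K\<^esub>"
    by (intro bexI[of _ "\<lambda>xs. - c xs"]) (auto simp: carrier_chain_group chain_uminus, simp add: chain_group_def)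
qed (auto simp: carrier_chain_group, auto simp: chain_group_def algebra_simps chain_add)

text \<open>
  When every cycle bounds, cycles and boundaries are the same subgroup, because the boundary of a
  boundary is zero; a group modulo itself is trivial.
\<close>

lemma trivial_reduced_homology:
  assumes K: "simplicial_complex K"
    and bnd: "\<And>z. chain p K z \<Longrightarrow> boundary z = (\<lambda>xs. 0) \<Longrightarrow> \<exists>b. chain (p + 1) K b \<and> boundary b = z"
  shows "trivial_group (reduced_homology p K)"
proof -
  let ?C = "\<lambda>p. chain_group p K"
  let ?Z = "kernel (?C p) (?C (p - 1)) boundary" and ?B = "boundary ` carrier (?C (p + 1))"
  have grp: "group (?C q)" for q
    using comm_group_chain_group by (rule comm_group.axioms(2))
  have hom: "group_hom (?C p) (?C (p - 1)) boundary"
    unfolding group_hom_def group_hom_axioms_def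
  proof (intro conjI grp homI)
    fix c d assume "c \<in> carrier (?C p)" "d \<in> carrier (?C p)"
    then have cd: "chain p K c" "chain p K d" by (simp_all add: carrier_chain_group)
    then show "boundary c \<in> carrier (?C (p - 1))"
      by (simp add: carrier_chain_group chain_boundary[OF K])
    show "boundary (c \<otimes>\<^bsub>?C p\<^esub> d) = boundary c \<otimes>\<^bsub>?C (p - 1)\<^esub> boundary d"
      using boundary_add[OF cd] by (simp add: chain_group_def fun_eq_iff)
  qed
  have "?Z = {z. chain p K z \<and> boundary z = (\<lambda>xs. 0)}"
    by (auto simp: kernel_def carrier_chain_group) (auto simp: chain_group_def)
  also have "\<dots> = ?B"
    using bnd chain_boundary[OF K, of "p + 1"] boundary_boundary[OF K, of "p + 1"]
    by (fastforce simp: carrier_chain_group)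
  finally have ZB: "?Z = ?B" .
  define G where "G = subgroup_generated (?C p) ?Z"
  define B where "B = ?B"
  have "subgroup ?Z (?C p)" by (rule group_hom.subgroup_kernel[OF hom])
  then have cG: "carrier G = B"
    by (simp only: subgroup.carrier_subgroup_generated_subgroup G_def B_def ZB)
  have comm: "comm_group G"
    unfolding G_def by (rule group.abelian_subgroup_generated[OF grp comm_group_chain_group])
  then interpret G: comm_group G .
  have sub: "subgroup B G" using G.subgroup_self by (simp add: cG)
  have "group (G Mod B)"
    by (rule normal.factorgroup_is_group[OF G.subgroup_imp_normal[OF sub]])
  moreover have "B #>\<^bsub>G\<^esub> x = B" if "x \<in> carrier G" for x
    using G.coset_join2[OF that sub] that by (simp add: cG)
  then have "carrier (G Mod B) = {B}"
    using G.one_closed by (auto simp: carrier_FactGroup)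
  ultimately have "trivial_group (G Mod B)"
    by (simp add: trivial_group_def)
  then show ?thesis
    by (simp only: reduced_homology_def G_def B_def)
qed

section \<open>Integer functionals and dual systems\<close>

definition pairing :: "int ^ 'n \<Rightarrow> int ^ 'n \<Rightarrow> int" where
  "pairing d v = (\<Sum>i\<in>UNIV. d $ i * v $ i)"

lemma pairing_simps [simp]:
  "pairing (d + e) v = pairing d v + pairing e v" "pairing d (v + w) = pairing d v + pairing d w"
  "pairing (d - e) v = pairing d v - pairing e v" "pairing d (v - w) = pairing d v - pairing d w"
  "pairing (k *s d) v = k * pairing d v" "pairing d (k *s v) = k * pairing d v"
  "pairing 0 v = 0" "pairing d 0 = 0"
  "pairing (axis i 1) v = v $ i"
  by (simp_all add: pairing_def algebra_simps sum.distrib sum_subtractf sum_distrib_left axis_def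
      if_distrib if_distribR cong: if_cong)

lemma pairing_sum_left: "pairing (\<Sum>x\<in>A. f x) v = (\<Sum>x\<in>A. pairing (f x) v)"
  by (induction A rule: infinite_finite_induct) auto

lemma pairing_sum_right: "pairing d (\<Sum>x\<in>A. f x) = (\<Sum>x\<in>A. pairing d (f x))"
  by (induction A rule: infinite_finite_induct) auto

lemma axis_one_nth: "axis j (1 :: int) $ i = (if i = j then 1 else 0)"
  by (simp add: axis_def)

text \<open>
  Additive maps to \<open>\<int>\<close> are automatically linear, hence given by their values on the standard
  basis. This turns coordinate functions on a summand into vectors.
\<close>

lemma additive_eq_pairing:
  fixes f :: "int ^ 'n \<Rightarrow> int"
  assumes add: "\<And>v w. f (v + w) = f v + f w"
  shows "\<exists>d. f = pairing d"
proof -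
  have f0: "f 0 = 0" using add[of 0 0] by simp
  have fsum: "f (\<Sum>x\<in>A. g x) = (\<Sum>x\<in>A. f (g x))" for g :: "'n \<Rightarrow> int ^ 'n" and A
    by (induction A rule: infinite_finite_induct) (auto simp: add f0)
  have nat: "f (int k *s v) = int k * f v" for k v
    by (induction k) (auto simp: f0 add algebra_simps vector_sadd_rdistrib)
  have scale: "f (k *s v) = k * f v" for k v
  proof (cases k rule: int_cases2)
    case (nonpos m)
    have "f (k *s v) + f (int m *s v) = 0"
      unfolding add[symmetric] by (simp add: nonpos f0 flip: vector_sadd_rdistrib)
    then show ?thesis by (simp add: nat nonpos)
  qed (simp add: nat)
  have "f v = pairing (\<chi> i. f (axis i 1)) v" for v
  proof -
    have "v = (\<Sum>i\<in>UNIV. v $ i *s axis i 1)"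
      by (simp add: vec_eq_iff axis_def if_distrib cong: if_cong)
    then have "f v = (\<Sum>i\<in>UNIV. f (v $ i *s axis i 1))" using fsum by metis
    then show ?thesis by (simp add: pairing_def scale mult.commute)
  qed
  then show ?thesis by blast
qed

text \<open>
  For finite sets this is an elementary form of unimodularity: it speaks only of integer
  functionals, which can be modified explicitly, instead of complements and ranks.
\<close>

definition has_dual_system :: "(int ^ 'n) set \<Rightarrow> bool" where
  "has_dual_system S \<longleftrightarrow> (\<forall>s\<in>S. \<exists>d. pairing d s = 1 \<and> (\<forall>t\<in>S - {s}. pairing d t = 0))"

lemma has_dual_system_subset: "has_dual_system S \<Longrightarrow> T \<subseteq> S \<Longrightarrow> has_dual_system T"
  unfolding has_dual_system_def by (meson Diff_iff subset_iff)

lemma has_dual_systemE: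
  assumes "has_dual_system S"
  obtains d where "\<forall>s\<in>S. \<forall>t\<in>S. pairing (d s) t = (if s = t then 1 else 0)"
proof -
  have "\<forall>s\<in>S. \<exists>d. \<forall>t\<in>S. pairing d t = (if s = t then 1 else 0)"
    using assms unfolding has_dual_system_def by (metis Diff_iff singletonD)
  then show ?thesis using that by metis
qed

section \<open>Ranks of integer lattices\<close>

definition rat_vec :: "int ^ 'n \<Rightarrow> rat ^ 'n" where
  "rat_vec v = (\<chi> i. of_int (v $ i))"

lemma rat_vec_simps [simp]:
  "rat_vec (v + w) = rat_vec v + rat_vec w" "rat_vec (k *s v) = of_int k *s rat_vec v"
  "rat_vec 0 = 0" "rat_vec (axis i 1) = axis i 1"
  by (simp_all add: rat_vec_def vec_eq_iff axis_def)

lemma rat_vec_eq_iff [simp]: "rat_vec v = rat_vec w \<longleftrightarrow> v = w"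
  by (simp add: rat_vec_def vec_eq_iff)

lemma inj_on_rat_vec: "inj_on rat_vec A"
  by (simp add: inj_on_def)

lemma rat_vec_sum: "rat_vec (\<Sum>x\<in>A. f x) = (\<Sum>x\<in>A. rat_vec (f x))"
  by (induction A rule: infinite_finite_induct) auto

lemma common_denominator:
  fixes u :: "'a \<Rightarrow> rat"
  assumes "finite A"
  shows "\<exists>N::int. N > 0 \<and> (\<forall>x\<in>A. of_int N * u x \<in> \<int>)"
  using assms
proof (induction rule: finite_induct)
  case empty
  then show ?case by (intro exI[of _ 1]) auto
next
  case (insert a A)
  then obtain N where N: "N > 0" "\<forall>x\<in>A. of_int N * u x \<in> \<int>" by blast
  obtain p q where pq: "quotient_of (u a) = (p, q)" by fastforce
  have q: "q > 0" "u a = of_int p / of_int q"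
    using quotient_of_denom_pos[OF pq] quotient_of_div[OF pq] by auto
  have "of_int (q * N) * u x \<in> \<int>" if "x \<in> insert a A" for x
  proof (cases "x = a")
    case True
    have "of_int (q * N) * u a = of_int (N * p)" using q by (simp add: field_simps)
    then show ?thesis using True Ints_of_int by metis
  next
    case False
    have "of_int (q * N) * u x = of_int q * (of_int N * u x)" by simp
    moreover have "of_int N * u x \<in> \<int>" using False that N by auto
    ultimately show ?thesis by (metis Ints_mult Ints_of_int)
  qed
  then show ?case
    using N q by (intro exI[of _ "q * N"]) auto
qed

text \<open>
  A rational linear relation becomes an integral one after multiplication with a common
  denominator. This makes dimension theory over the field \<open>\<rat>\<close> available for ranks over \<open>\<int>\<close>.
\<close>

lemma independent_rat_vec_iff:
  assumes B: "finite B"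
  shows "vec.independent (rat_vec ` B) \<longleftrightarrow> int_vec.independent B"
proof
  assume ind: "vec.independent (rat_vec ` B)"
  show "int_vec.independent B"
    unfolding int_vec.independent_explicit_module
  proof (intro allI impI)
    fix T u v assume T: "finite T" "T \<subseteq> B" "(\<Sum>v\<in>T. u v *s v) = 0" "v \<in> T"
    have "(\<Sum>v\<in>rat_vec ` T. of_int (u (inv_into UNIV rat_vec v)) *s v) = rat_vec (\<Sum>v\<in>T. u v *s v)"
      by (subst sum.reindex) (auto simp: inj_on_rat_vec rat_vec_sum)
    also have "\<dots> = 0" by (simp add: T)
    finally have "(of_int (u (inv_into UNIV rat_vec (rat_vec v))) :: rat) = 0"
      using ind T unfolding vec.independent_explicit_module
      by (meson finite_imageI image_mono imageI)
    then show "u v = 0" by (simp add: inj_on_rat_vec)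
  qed
next
  assume ind: "int_vec.independent B"
  show "vec.independent (rat_vec ` B)"
  proof (rule vec.independent_if_scalars_zero)
    fix f x assume 0: "(\<Sum>x\<in>rat_vec ` B. f x *s x) = 0" and "x \<in> rat_vec ` B"
    then obtain v where v: "v \<in> B" "x = rat_vec v" by blast
    obtain N where N: "N > 0" "\<forall>v\<in>B. of_int N * f (rat_vec v) \<in> \<int>"
      using common_denominator[OF B, of "\<lambda>v. f (rat_vec v)"] by blast
    define u where "u = (\<lambda>v. \<lfloor>of_int N * f (rat_vec v)\<rfloor>)"
    have u: "of_int (u v) = of_int N * f (rat_vec v)" if "v \<in> B" for v
      using N that by (simp add: u_def)
    have "rat_vec (\<Sum>v\<in>B. u v *s v) = (\<Sum>v\<in>B. of_int N *s (f (rat_vec v) *s rat_vec v))"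
      unfolding rat_vec_sum by (rule sum.cong) (auto simp: u vector_smult_assoc)
    also have "\<dots> = of_int N *s (\<Sum>x\<in>rat_vec ` B. f x *s x)"
      by (subst sum.reindex) (auto simp: inj_on_rat_vec vec.scale_sum_right)
    also have "\<dots> = rat_vec 0" by (simp add: 0)
    finally have "(\<Sum>v\<in>B. u v *s v) = 0" unfolding rat_vec_eq_iff .
    then have "u v = 0"
      using ind B v unfolding int_vec.independent_explicit_module by (meson order_refl)
    then show "f x = 0" using u[OF v(1)] v N by simp
  qed (use B in simp)
qed

lemma rat_vec_span: "v \<in> int_vec.span S \<Longrightarrow> rat_vec v \<in> vec.span (rat_vec ` S)"
proof (induction rule: int_vec.span_induct_alt)
  case base
  then show ?case by (simp add: vec.span_zero)
next
  case (step c x y)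
  then show ?case by (simp add: vec.span_add vec.span_scale vec.span_base)
qed

lemma independent_card_le_span:
  assumes "finite S" "finite B" "int_vec.independent B" "B \<subseteq> int_vec.span S"
  shows "card B \<le> card S"
proof -
  have "card (rat_vec ` B) \<le> card (rat_vec ` S)"
    using vec.independent_span_bound[of "rat_vec ` S" "rat_vec ` B"] assms rat_vec_span
    by (auto simp: independent_rat_vec_iff)
  then show ?thesis by (simp add: card_image inj_on_rat_vec)
qed

lemma independent_card_le_CARD:
  fixes B :: "(int ^ 'n) set"
  assumes "finite B" "int_vec.independent B"
  shows "card B \<le> CARD('n)"
proof -
  have "card (rat_vec ` B) \<le> vec.dim (UNIV :: (rat ^ 'n) set)"
    using assms by (intro vec.independent_card_le_dim) (auto simp: independent_rat_vec_iff)
  then show ?thesis by (simp add: card_image inj_on_rat_vec card_cart_basis)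
qed

lemma rank_properties:
  fixes A :: "(int ^ 'n) set"
  shows "\<exists>B. finite B \<and> B \<subseteq> A \<and> int_vec.independent B \<and> card B = Defs.rank A"
    and "finite C \<Longrightarrow> C \<subseteq> A \<Longrightarrow> int_vec.independent C \<Longrightarrow> card C \<le> Defs.rank A"
proof -
  let ?R = "{card B | B. finite B \<and> B \<subseteq> A \<and> int_vec.independent B}"
  have fin: "finite ?R"
    by (rule finite_subset[of _ "{..CARD('n)}"]) (auto simp: independent_card_le_CARD)
  have "int_vec.independent ({} :: (int ^ 'n) set)"
    by (simp add: int_vec.independent_explicit_module)
  then have "0 \<in> ?R" by force
  then have "Max ?R \<in> ?R" using fin by (intro Max_in) auto
  then show "\<exists>B. finite B \<and> B \<subseteq> A \<and> int_vec.independent B \<and> card B = Defs.rank A"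
    by (auto simp: rank_def)
  show "card C \<le> Defs.rank A" if "finite C" "C \<subseteq> A" "int_vec.independent C"
    unfolding rank_def using fin that by (intro Max_ge) auto
qed

section \<open>Unimodular sets and dual systems\<close>

text \<open>
  A dual system reads off coefficients; independence and the existence of a complement both
  rest on this.
\<close>

lemma dual_system_coefficient:
  assumes "finite S" "\<forall>s\<in>S. \<forall>t\<in>S. pairing (d s) t = (if s = t then 1 else 0)" "s \<in> S"
  shows "pairing (d s) (\<Sum>t\<in>S. u t *s t) = u s"
proof -
  have "pairing (d s) (\<Sum>t\<in>S. u t *s t) = (\<Sum>t\<in>S. u t * pairing (d s) t)"
    by (simp add: pairing_sum_right)
  also have "\<dots> = (\<Sum>t\<in>S. if t = s then u t else 0)"
    using assms by (intro sum.cong) auto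
  finally show ?thesis using assms by simp
qed

lemma has_dual_system_independent:
  assumes "has_dual_system S"
  shows "int_vec.independent S"
  unfolding int_vec.independent_explicit_module
proof (intro allI impI)
  fix T u v assume T: "finite T" "T \<subseteq> S" "(\<Sum>v\<in>T. u v *s v) = 0" "v \<in> T"
  obtain d where "\<forall>s\<in>T. \<forall>t\<in>T. pairing (d s) t = (if s = t then 1 else 0)"
    using has_dual_systemE[OF has_dual_system_subset[OF assms T(2)]] by metis
  from dual_system_coefficient[OF T(1) this T(4), of u] show "u v = 0"
    by (simp add: T(3))
qed

text \<open>
  If the span is a summand of rank \<open>card S\<close>, then \<open>S\<close> is a basis of it by a dimension count
  over \<open>\<rat>\<close>, and its coordinate functions extend by the projection along a complement.
  Conversely, the common kernel of a dual system is a complement of the span.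
\<close>

lemma unimodular_iff: "unimodular S \<longleftrightarrow> finite S \<and> has_dual_system S"
proof
  assume "unimodular S"
  then have fin: "finite S" and ds: "direct_summand (int_vec.span S)"
    and rk: "Defs.rank (int_vec.span S) = card S"
    by (auto simp: unimodular_def)
  obtain B where B: "finite B" "B \<subseteq> int_vec.span S" "int_vec.independent B" "card B = card S"
    using rank_properties(1)[of "int_vec.span S"] rk by metis
  have ind: "int_vec.independent S"
  proof -
    have "rat_vec ` B \<subseteq> vec.span (rat_vec ` S)" using B rat_vec_span by blast
    then have "card (rat_vec ` S) \<le> vec.dim (vec.span (rat_vec ` S))"
      using B vec.independent_card_le_dim[of "rat_vec ` B" "vec.span (rat_vec ` S)"]
      by (simp add: independent_rat_vec_iff card_image inj_on_rat_vec)
    then have "vec.independent (rat_vec ` S)"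
      by (intro vec.card_le_dim_spanning[of _ "vec.span (rat_vec ` S)"])
        (auto simp: fin vec.span_base)
    then show ?thesis by (simp add: independent_rat_vec_iff fin)
  qed
  obtain C where C: "int_vec.subspace C" "int_vec.span S \<inter> C = {0}"
    "{a + b | a b. a \<in> int_vec.span S \<and> b \<in> C} = UNIV"
    using ds unfolding direct_summand_def by blast
  have "\<forall>v. \<exists>a. a \<in> int_vec.span S \<and> v - a \<in> C"
  proof
    fix v
    have "v \<in> {a + b | a b. a \<in> int_vec.span S \<and> b \<in> C}" using C by blast
    then show "\<exists>a. a \<in> int_vec.span S \<and> v - a \<in> C" by auto
  qed
  then obtain P where P: "\<And>v. P v \<in> int_vec.span S" "\<And>v. v - P v \<in> C" by metis
  have unique: "P v = a" if "a \<in> int_vec.span S" "v - a \<in> C" for v a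
  proof -
    have "P v - a \<in> int_vec.span S" using P that int_vec.span_diff by blast
    moreover have "(v - a) - (v - P v) \<in> C"
      using P that C(1) by (meson int_vec.subspace_diff)
    then have "P v - a \<in> C" by simp
    ultimately have "P v - a \<in> {0}" using C by blast
    then show ?thesis by simp
  qed
  have P_add: "P (v + w) = P v + P w" for v w
  proof (rule unique)
    show "P v + P w \<in> int_vec.span S" using P int_vec.span_add by blast
    have "(v - P v) + (w - P w) \<in> C" using P C by (meson int_vec.subspace_add)
    then show "v + w - (P v + P w) \<in> C" by (simp add: algebra_simps)
  qed
  have P_S: "P s = s" if "s \<in> S" for s
    using that C by (intro unique) (auto simp: int_vec.span_base int_vec.subspace_0)
  have "has_dual_system S"
    unfolding has_dual_system_def
  proof
    fix s assume s: "s \<in> S"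
    obtain d where d: "(\<lambda>v. int_vec.representation S (P v) s) = pairing d"
      using additive_eq_pairing[of "\<lambda>v. int_vec.representation S (P v) s"]
      by (auto simp: P_add int_vec.representation_add[OF ind P(1) P(1)])
    have "pairing d t = (if s = t then 1 else 0)" if "t \<in> S" for t
      using int_vec.representation_basis[OF ind that] P_S[OF that] by (simp flip: d)
    then show "\<exists>d. pairing d s = 1 \<and> (\<forall>t\<in>S - {s}. pairing d t = 0)"
      using s by (intro exI[of _ d]) auto
  qed
  then show "finite S \<and> has_dual_system S" using fin by simp
next
  assume *: "finite S \<and> has_dual_system S"
  then have fin: "finite S" by simp
  obtain d where d: "\<forall>s\<in>S. \<forall>t\<in>S. pairing (d s) t = (if s = t then 1 else 0)"
    using * has_dual_systemE by metis
  note coeff = dual_system_coefficient[OF fin d]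
  let ?C = "{v. \<forall>s\<in>S. pairing (d s) v = 0}"
  have "int_vec.subspace ?C" by (auto simp: int_vec.subspace_def)
  moreover have "int_vec.span S \<inter> ?C = {0}"
  proof -
    have "v = 0" if v: "v \<in> int_vec.span S" "v \<in> ?C" for v
    proof -
      obtain u where u: "v = (\<Sum>t\<in>S. u t *s t)"
        using v(1) int_vec.span_finite[OF fin] by auto
      then have "u s = 0" if "s \<in> S" for s using coeff[OF that, of u] that v(2) by auto
      then show ?thesis by (simp add: u)
    qed
    then show ?thesis by (auto simp: int_vec.span_zero)
  qed
  moreover have "v \<in> {a + b | a b. a \<in> int_vec.span S \<and> b \<in> ?C}" for v
  proof -
    let ?a = "\<Sum>t\<in>S. pairing (d t) v *s t"
    have "?a \<in> int_vec.span S"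
      by (intro int_vec.span_sum int_vec.span_scale int_vec.span_base)
    moreover have "v - ?a \<in> ?C" using coeff[of _ "\<lambda>t. pairing (d t) v"] by simp
    moreover have "v = ?a + (v - ?a)" by simp
    ultimately show ?thesis by blast
  qed
  ultimately have ds: "direct_summand (int_vec.span S)"
    unfolding direct_summand_def by (intro conjI exI[of _ ?C]) (auto simp: int_vec.subspace_span)
  have "card S \<le> Defs.rank (int_vec.span S)"
    using * by (intro rank_properties(2)) (auto simp: has_dual_system_independent int_vec.span_base)
  moreover have "Defs.rank (int_vec.span S) \<le> card S"
    using rank_properties(1)[of "int_vec.span S"] independent_card_le_span[OF fin] by metis
  ultimately show "unimodular S" using ds fin by (simp add: unimodular_def)
qed

lemma unimodular_card_le:
  fixes S :: "(int ^ 'n) set"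
  shows "unimodular S \<Longrightarrow> card S \<le> CARD('n)"
  by (simp add: unimodular_iff independent_card_le_CARD has_dual_system_independent)

lemma unimodular_subset: "unimodular S \<Longrightarrow> T \<subseteq> S \<Longrightarrow> unimodular T"
  unfolding unimodular_iff using finite_subset has_dual_system_subset by blast

lemma unimodular_empty [simp]: "unimodular {}"
  by (simp add: unimodular_iff has_dual_system_def)

text \<open>
  Among all positive values of integer functionals at \<open>x\<close> the least one, \<open>m\<close>, divides every
  coordinate of \<open>x\<close>: a nonzero remainder would be a smaller value. Hence \<open>m\<close> can be divided out.
\<close>

lemma primitive_direction:
  fixes x :: "int ^ 'n"
  assumes "x \<noteq> 0"
  obtains k y g where "x = k *s y" "k \<noteq> 0" "pairing g y = 1"
proof -
  let ?P = "\<lambda>m. 0 < m \<and> (\<exists>g. pairing g x = int m)"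
  obtain i where i: "x $ i \<noteq> 0" using assms by (auto simp: vec_eq_iff)
  have "pairing (sgn (x $ i) *s axis i 1) x = int (nat \<bar>x $ i\<bar>)"
    by (simp add: sgn_if)
  then have "?P (nat \<bar>x $ i\<bar>)" using i by (intro conjI exI[of _ "sgn (x $ i) *s axis i 1"]) auto
  then have least: "?P (LEAST m. ?P m)" by (rule LeastI)
  define m where "m = (LEAST m. ?P m)"
  obtain g where m: "0 < m" and g: "pairing g x = int m" using least by (auto simp: m_def)
  have "int m dvd x $ j" for j
  proof (rule ccontr)
    assume "\<not> int m dvd x $ j"
    then have r: "0 < x $ j mod int m" "x $ j mod int m < int m"
      using m by (auto simp: dvd_eq_mod_eq_0 le_neq_trans)
    have "pairing (axis j 1 - (x $ j div int m) *s g) x = x $ j mod int m"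
      by (simp add: g minus_div_mult_eq_mod)
    then have "?P (nat (x $ j mod int m))" using r by (intro conjI exI[of _ "axis j 1 - (x $ j div int m) *s g"]) auto
    then have "m \<le> nat (x $ j mod int m)" unfolding m_def by (rule Least_le)
    then show False using r by simp
  qed
  then have x: "x = int m *s (\<chi> j. x $ j div int m)" by (simp add: vec_eq_iff)
  have "int m * pairing g (\<chi> j. x $ j div int m) = int m"
    using g by (subst (asm) x) simp
  then have "pairing g (\<chi> j. x $ j div int m) = 1" using m by simp
  then show ?thesis using that[OF x] m by simp
qed

text \<open>
  Some vector lies outside the span of \<open>S\<close> by a dimension count. Its component in the common
  kernel of a dual system is nonzero, and its primitive direction can serve as \<open>e\<close>; correcting the
  functional \<open>g\<close> found for \<open>e\<close> by the dual system makes it vanish on \<open>S\<close> without changing its value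
  at \<open>e\<close>.
\<close>

lemma unimodular_extend:
  fixes S :: "(int ^ 'n) set"
  assumes S: "unimodular S" "card S < CARD('n)"
  obtains e g where "pairing g e = 1" "\<And>s. s \<in> S \<Longrightarrow> pairing g s = 0"
proof -
  have fin: "finite S" using S by (simp add: unimodular_iff)
  obtain d where d: "\<forall>s\<in>S. \<forall>t\<in>S. pairing (d s) t = (if s = t then 1 else 0)"
    using S has_dual_systemE unfolding unimodular_iff by metis
  note coeff = dual_system_coefficient[OF fin d]
  have "\<exists>v. v \<notin> int_vec.span S"
  proof (rule ccontr)
    assume "\<not> ?thesis"
    moreover have "inj (\<lambda>i::'n. axis i (1::int))" by (auto simp: inj_def axis_eq_axis)
    moreover have "int_vec.independent (range (\<lambda>i::'n. axis i (1::int)))"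
    proof (rule has_dual_system_independent, unfold has_dual_system_def, intro ballI)
      fix s :: "int ^ 'n" assume "s \<in> range (\<lambda>i. axis i 1)"
      then obtain i where "s = axis i 1" by blast
      then show "\<exists>d. pairing d s = 1 \<and> (\<forall>t\<in>range (\<lambda>i. axis i 1) - {s}. pairing d t = 0)"
        by (intro exI[of _ "axis i 1"]) (auto simp: axis_one_nth split: if_splits)
    qed
    ultimately show False
      using independent_card_le_span[OF fin, of "range (\<lambda>i::'n. axis i 1)"] S(2)
      by (auto simp: card_image)
  qed
  then obtain v where v: "v \<notin> int_vec.span S" by blast
  define x where "x = v - (\<Sum>t\<in>S. pairing (d t) v *s t)"
  have dx: "pairing (d s) x = 0" if "s \<in> S" for s
    using coeff[OF that] by (simp add: x_def)
  have "(\<Sum>t\<in>S. pairing (d t) v *s t) \<in> int_vec.span S"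
    by (intro int_vec.span_sum int_vec.span_scale int_vec.span_base)
  then have "x \<noteq> 0" using v by (auto simp: x_def)
  then obtain k e g where e: "x = k *s e" "k \<noteq> 0" "pairing g e = 1"
    by (rule primitive_direction)
  have de: "pairing (d s) e = 0" if "s \<in> S" for s using dx[OF that] e by simp
  define h where "h = g - (\<Sum>t\<in>S. pairing g t *s d t)"
  have "pairing h e = 1" using e de by (simp add: h_def pairing_sum_left)
  moreover have "pairing h s = 0" if "s \<in> S" for s
  proof -
    have "(\<Sum>t\<in>S. pairing g t * pairing (d t) s) = (\<Sum>t\<in>S. if t = s then pairing g t else 0)"
      using d that by (intro sum.cong) auto
    then show ?thesis using that fin by (simp add: h_def pairing_sum_left)
  qed
  ultimately show ?thesis by (rule that)
qed

text \<open>
  A functional dual to some \<open>s \<in> S\<close> is corrected by a multiple of \<open>g\<close> so that it vanishes at \<open>e\<close>.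
\<close>

lemma unimodular_insert:
  assumes S: "unimodular S" and "pairing g e = 1" "\<And>s. s \<in> S \<Longrightarrow> pairing g s = 0"
  shows "unimodular (insert e S)"
proof -
  have "\<exists>d. pairing d s = 1 \<and> (\<forall>t\<in>insert e S - {s}. pairing d t = 0)" if s: "s \<in> S" for s
  proof -
    obtain d where "pairing d s = 1" "\<forall>t\<in>S - {s}. pairing d t = 0"
      using S s unfolding unimodular_iff has_dual_system_def by blast
    then show ?thesis using assms s by (intro exI[of _ "d - pairing d e *s g"]) auto
  qed
  then show ?thesis
    using assms unfolding unimodular_iff has_dual_system_def by auto
qed

text \<open>
  The multiple \<open>q v\<close> may depend on \<open>v\<close> in any way, so this is not the effect of one linear map.
  The dual system survives nevertheless: only the functional dual to \<open>w\<close> changes, namely by the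
  sum of the \<open>q v\<close>-multiples of the functionals dual to the \<open>v \<in> U\<close>.
\<close>

lemma unimodular_shear:
  fixes q :: "int ^ 'n \<Rightarrow> int"
  assumes TU: "unimodular (T \<union> U)" "T \<inter> U = {}" and w: "w \<in> T"
  defines "\<phi> \<equiv> \<lambda>v. v - q v *s w"
  shows "inj_on \<phi> U" "T \<inter> \<phi> ` U = {}" "unimodular (T \<union> \<phi> ` U)"
proof -
  have fin: "finite T" "finite U" using TU by (auto simp: unimodular_iff)
  obtain d where d: "\<forall>s\<in>T \<union> U. \<forall>t\<in>T \<union> U. pairing (d s) t = (if s = t then 1 else 0)"
    using TU has_dual_systemE unfolding unimodular_iff by metis
  have wU: "w \<notin> U" using w TU by blast
  have dphi: "pairing (d s) (\<phi> v) = (if s = v then 1 else 0)" if "s \<in> T \<union> U" "s \<noteq> w" "v \<in> U" for s v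
    using that d w by (auto simp: \<phi>_def)
  show "inj_on \<phi> U"
  proof (rule inj_onI)
    fix u v assume uv: "u \<in> U" "v \<in> U" "\<phi> u = \<phi> v"
    then have "u \<noteq> w" using wU by blast
    then show "u = v" using dphi[of u u] dphi[of u v] uv by (auto split: if_splits)
  qed
  show disj: "T \<inter> \<phi> ` U = {}"
  proof (rule ccontr)
    assume "T \<inter> \<phi> ` U \<noteq> {}"
    then obtain v where v: "v \<in> U" "\<phi> v \<in> T" by blast
    then have "v \<noteq> w" "v \<noteq> \<phi> v" using wU TU by auto
    then show False using dphi[of v v] d v by auto
  qed
  have "has_dual_system (T \<union> \<phi> ` U)"
    unfolding has_dual_system_def
  proof
    fix s assume s: "s \<in> T \<union> \<phi> ` U"
    show "\<exists>d. pairing d s = 1 \<and> (\<forall>t\<in>T \<union> \<phi> ` U - {s}. pairing d t = 0)"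
    proof (cases "s = w")
      case True
      let ?g = "d w + (\<Sum>v\<in>U. q v *s d v)"
      have dU: "pairing (d v) t = 0" if "v \<in> U" "t \<in> T" for v t
        using that d TU(2) by (metis Un_iff disjoint_iff)
      have "pairing ?g t = (if t = w then 1 else 0)" if "t \<in> T" for t
        using that d w by (simp add: pairing_sum_left dU)
      moreover have "pairing ?g (\<phi> v) = 0" if v: "v \<in> U" for v
      proof -
        have "(\<Sum>u\<in>U. q u * pairing (d u) (\<phi> v)) = (\<Sum>u\<in>U. if u = v then q u else 0)"
        proof (intro sum.cong refl)
          fix u assume u: "u \<in> U"
          then have "u \<noteq> w" using wU by blast
          then show "q u * pairing (d u) (\<phi> v) = (if u = v then q u else 0)"
            using dphi[of u v] u v by simp
        qed
        also have "\<dots> = q v" using v fin by simp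
        finally have "(\<Sum>u\<in>U. q u * pairing (d u) (\<phi> v)) = q v" .
        moreover have "pairing (d w) (\<phi> v) = - q v" using d w v wU by (auto simp: \<phi>_def)
        ultimately show ?thesis by (simp add: pairing_sum_left)
      qed
      ultimately show ?thesis using True w by (intro exI[of _ ?g]) (auto split: if_splits)
    next
      case False
      obtain s' where s': "s' \<in> T \<union> U" "s' \<noteq> w" "s = (if s' \<in> T then s' else \<phi> s')"
      proof (cases "s \<in> T")
        case True
        then show ?thesis using that[of s] False by simp
      next
        case notT: False
        then obtain v where v: "v \<in> U" "s = \<phi> v" using s by blast
        then have "v \<noteq> w" "v \<notin> T" using wU TU(2) by auto
        then show ?thesis using that[of v] v by simp
      qed
      have "pairing (d s') t = (if t = s' then 1 else 0)" if "t \<in> T" for t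
        using that s' d by auto
      then show ?thesis
        using s' dphi[OF s'(1,2)] TU(2)
        by (intro exI[of _ "d s'"]) (auto split: if_splits)
    qed
  qed
  then show "unimodular (T \<union> \<phi> ` U)" using fin by (simp add: unimodular_iff)
qed

section \<open>Acyclicity and the Cohen-Macaulay property\<close>

lemma cycles_bound_negative: "d < -1 \<Longrightarrow> cycles_bound d K L"
  unfolding cycles_bound_def
proof (intro allI impI, elim conjE)
  fix p z assume "d < -1" "p \<le> d" and z: "chain p K z"
  then have "z = (\<lambda>xs. 0)"
    using chain_support(3)[OF z] by fastforce
  then show "\<exists>b. chain (p + 1) L b \<and> boundary b = z"
    by (intro exI[of _ "\<lambda>xs. 0"]) (simp add: boundary_zero)
qed

text \<open>
  A cycle has finitely many vertices, so it lies in a subcomplex spanned by a finite set.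
\<close>

lemma cycles_bound_locally_finite:
  assumes "\<And>F. finite F \<Longrightarrow> F \<subseteq> V \<Longrightarrow> \<exists>W. F \<subseteq> W \<and> cycles_bound d (full_subcomplex K W) L"
  shows "cycles_bound d (full_subcomplex K V) L"
  unfolding cycles_bound_def
proof (intro allI impI, elim conjE)
  fix p z assume p: "p \<le> d" and z: "chain p (full_subcomplex K V) z" "boundary z = (\<lambda>xs. 0)"
  have "chain_vertices z \<subseteq> V"
    using chain_support(2)[OF z(1)] by (auto simp: chain_vertices_def full_subcomplex_def)
  then obtain W where W: "chain_vertices z \<subseteq> W" "cycles_bound d (full_subcomplex K W) L"
    using assms[OF finite_chain_vertices[OF z(1)]] by blast
  have "chain p (full_subcomplex K W) z"
    by (rule chain_mono[OF z(1)])
      (use chain_support(2)[OF z(1)] W(1) in \<open>auto simp: full_subcomplex_def chain_vertices_def\<close>)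
  then show "\<exists>b. chain (p + 1) L b \<and> boundary b = z"
    using W(2) p z(2) unfolding cycles_bound_def by blast
qed

lemma link_link: "w \<notin> \<sigma> \<Longrightarrow> link (link K \<sigma>) {w} = link K (insert w \<sigma>)"
  by (auto simp: link_def)

text \<open>
  The dimension of the link of \<open>\<sigma>\<close> is at most \<open>n - card \<sigma> - 1\<close>. Below its actual dimension acyclicity applies, and
  above it there are no nonzero chains.
\<close>

lemma cohen_macaulayI:
  assumes K: "simplicial_complex K" and n: "\<And>\<sigma>. \<sigma> \<in> K \<Longrightarrow> card \<sigma> \<le> n"
    and ac: "\<And>\<sigma>. \<sigma> \<in> K \<Longrightarrow> acyclic_upto (int n - int (card \<sigma>) - 2) (link K \<sigma>)"
  shows "cohen_macaulay K"
  unfolding cohen_macaulay_def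
proof (intro conjI K ballI allI impI)
  show "finite_dimensional_complex K"
    unfolding finite_dimensional_complex_def using n by blast
  fix \<sigma> p assume \<sigma>: "\<sigma> \<in> K" and p: "p \<noteq> complex_dim (link K \<sigma>)"
  let ?L = "link K \<sigma>"
  note sL = simplicial_complex_link[OF K \<sigma>]
  have card: "card \<sigma> + card \<tau> \<le> n" if "\<tau> \<in> ?L" for \<tau>
  proof -
    have *: "\<sigma> \<union> \<tau> \<in> K" "\<sigma> \<inter> \<tau> = {}" using that by (auto simp: link_def)
    then have "finite (\<sigma> \<union> \<tau>)" using K by (auto simp: simplicial_complex_def)
    then show ?thesis using n[OF *(1)] *(2) by (simp add: card_Un_disjoint)
  qed
  define dims where "dims = (\<lambda>\<tau>. int (card \<tau>) - 1) ` ?L"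
  have "dims \<subseteq> {-1..int n}" using card by (force simp: dims_def)
  then have fin: "finite dims" by (rule finite_subset) simp
  have "{} \<in> ?L" using sL by (simp add: simplicial_complex_def)
  then have "dims \<noteq> {}" by (auto simp: dims_def)
  then have "Max dims \<in> dims" using fin by simp
  then have le: "Max dims \<le> int n - int (card \<sigma>) - 1"
    using card by (force simp: dims_def)
  have ge: "int (card \<tau>) - 1 \<le> Max dims" if "\<tau> \<in> ?L" for \<tau>
    using fin that by (auto simp: dims_def intro!: Max_ge)
  have D: "complex_dim ?L = Max dims" by (simp add: complex_dim_def dims_def)
  show "trivial_group (reduced_homology p ?L)"
  proof (rule trivial_reduced_homology[OF sL])
    fix z assume z: "chain p ?L z" "boundary z = (\<lambda>xs. 0)"
    show "\<exists>b. chain (p + 1) ?L b \<and> boundary b = z"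
    proof (cases "p < Max dims")
      case True
      then show ?thesis using ac[OF \<sigma>] z le unfolding cycles_bound_def by auto
    next
      case False
      have "z xs = 0" for xs
      proof (rule ccontr)
        assume "z xs \<noteq> 0"
        from chain_support[OF z(1) this] show False
          using ge[of "set xs"] False p D by (simp add: distinct_card)
      qed
      then show ?thesis
        by (intro exI[of _ "\<lambda>xs. 0"]) (auto simp: boundary_zero)
    qed
  qed
qed

section \<open>Links of unimodular sets\<close>

lemma simplicial_complex_X: "simplicial_complex X_complex"
  unfolding simplicial_complex_def X_complex_def
  using unimodular_subset by (auto simp: unimodular_iff[of "_ :: (int ^ _) set"] has_dual_system_def)

lemma mem_X_complex [simp]: "S \<in> X_complex \<longleftrightarrow> unimodular S"
  by (simp add: X_complex_def)

lemma mem_link_X: "U \<in> link X_complex T \<longleftrightarrow> unimodular (T \<union> U) \<and> T \<inter> U = {}"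
  by (simp add: link_def)

text \<open>
  The absolute value of the functional \<open>g\<close> plays the role of a height.
\<close>

definition below :: "int ^ 'n \<Rightarrow> int \<Rightarrow> (int ^ 'n) set" where
  "below g R = {v. \<bar>pairing g v\<bar> < R}"

text \<open>
  The part of the link of \<open>T\<close> below the height of \<open>w \<in> T\<close> is a retract of the whole link:
  division with remainder by \<open>pairing g w\<close> lowers the height of any vertex by subtracting a multiple
  of \<open>w\<close>, which preserves unimodularity together with \<open>T\<close>. This is the only use of the Euclidean
  algorithm for \<open>\<int>\<close> in the topological argument.
\<close>

lemma acyclic_link_below:
  fixes T :: "(int ^ 'n) set"
  assumes ac: "acyclic_upto d (link X_complex T)" and w: "w \<in> T" "pairing g w \<noteq> 0"
  shows "acyclic_upto d (full_subcomplex (link X_complex T) (below g \<bar>pairing g w\<bar>))"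
    (is "acyclic_upto d ?B")
proof -
  \<comment> \<open>A retraction has to fix the vertices that are low already; those where \<open>g\<close> and \<open>g w\<close>
  have opposite signs would be moved by division with remainder.\<close>
  define q where "q = (\<lambda>v. if \<bar>pairing g v\<bar> < \<bar>pairing g w\<bar> then 0 else pairing g v div pairing g w)"
  define \<phi> where "\<phi> = (\<lambda>v. v - q v *s w)"
  have below: "\<phi> v \<in> below g \<bar>pairing g w\<bar>" for v
    using w abs_mod_less[of "pairing g w" "pairing g v"]
    by (simp add: below_def \<phi>_def q_def minus_div_mult_eq_mod)
  show ?thesis
  proof (rule acyclic_upto_retract[OF ac])
    show "simplicial_embedding (\<lambda>v. v) ?B (link X_complex T)"
      by (auto simp: simplicial_embedding_def full_subcomplex_def)
    show "simplicial_embedding \<phi> (link X_complex T) ?B"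
      unfolding simplicial_embedding_def
    proof
      fix U assume "U \<in> link X_complex T"
      then show "inj_on \<phi> U \<and> \<phi> ` U \<in> ?B"
        using unimodular_shear[of T U w q, folded \<phi>_def] w(1) below
        by (auto simp: mem_link_X full_subcomplex_def)
    qed
    show "\<phi> v = v" if "v \<in> \<Union> ?B" for v
      using that by (auto simp: full_subcomplex_def below_def \<phi>_def q_def)
  qed
qed

text \<open>
  Vertices of height exactly \<open>R\<close> are added one at a time. Attaching \<open>x\<close> glues a cone over the
  corresponding subcomplex of the link of \<open>insert x T\<close>, which is acyclic in one degree less by
  induction; the set \<open>insert x T\<close> still contains \<open>w\<close>.
\<close>

lemma acyclic_link_below_Un:
  fixes T :: "(int ^ 'n) set"
  assumes ac: "\<And>T :: (int ^ 'n) set. unimodular T \<Longrightarrow> k < card T \<Longrightarrow>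
      acyclic_upto (int CARD('n) - int (card T) - 2) (link X_complex T)"
    and F: "finite F" "F \<subseteq> {v. \<bar>pairing g v\<bar> = R}" and R: "R > 0"
    and T: "unimodular T" "k < card T" "w \<in> T" "\<bar>pairing g w\<bar> = R"
  shows "acyclic_upto (int CARD('n) - int (card T) - 2)
      (full_subcomplex (link X_complex T) (below g R \<union> F))"
  using F T
proof (induction F arbitrary: T rule: finite_induct)
  case empty
  then show ?case
    using acyclic_link_below[OF ac[of T], of w g] R by auto
next
  case (insert x F)
  let ?Lk = "link X_complex T" and ?d = "int CARD('n) - int (card T) - 2"
  have "cycles_bound ?d (full_subcomplex ?Lk (insert x (below g R \<union> F)))
      (full_subcomplex ?Lk (insert x (below g R \<union> F)))"
  proof (rule cycles_bound_insert_vertex)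
    show "simplicial_complex ?Lk"
      using simplicial_complex_X insert.prems by (intro simplicial_complex_link) auto
    show "x \<notin> below g R \<union> F" using insert by (auto simp: below_def)
    have "acyclic_upto ?d (full_subcomplex ?Lk (below g R \<union> F))"
      using insert by (intro insert.IH) auto
    moreover have "full_subcomplex ?Lk (below g R \<union> F) \<subseteq> full_subcomplex ?Lk (insert x (below g R \<union> F))"
      by (auto simp: full_subcomplex_def)
    ultimately show "cycles_bound ?d (full_subcomplex ?Lk (below g R \<union> F))
        (full_subcomplex ?Lk (insert x (below g R \<union> F)))"
      by (rule cycles_bound_mono)
    assume "{x} \<in> ?Lk"
    then have x: "x \<notin> T" "unimodular (insert x T)" by (auto simp: mem_link_X)
    have "finite T" using insert.prems by (simp add: unimodular_iff)
    then have c: "card (insert x T) = Suc (card T)" using x by simp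
    have "acyclic_upto (int CARD('n) - int (card (insert x T)) - 2)
        (full_subcomplex (link X_complex (insert x T)) (below g R \<union> F))"
      using insert.prems x c by (intro insert.IH) auto
    then show "acyclic_upto (?d - 1) (full_subcomplex (link ?Lk {x}) (below g R \<union> F))"
      using x c by (simp add: link_link algebra_simps)
  qed simp
  then show ?case by simp
qed

text \<open>
  Induction on the corank of \<open>S\<close>. Choose \<open>e\<close> and a height \<open>g\<close> with \<open>g e = 1\<close> that vanishes on \<open>S\<close>.
  The part of the link at height \<open>0\<close> is coned off by \<open>e\<close> inside the link. A cycle reaching height
  \<open>R > 0\<close> is pushed off its finitely many top vertices one by one, because the relevant part of the
  link of each is acyclic by the induction hypothesis; thus the height can be lowered to \<open>0\<close>.
\<close>

lemma acyclic_link_X: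
  fixes S :: "(int ^ 'n) set"
  assumes "unimodular S"
  shows "acyclic_upto (int CARD('n) - int (card S) - 2) (link X_complex S)"
  using assms
proof (induction "CARD('n) - card S" arbitrary: S rule: less_induct)
  case less
  let ?Lk = "link X_complex S" and ?d = "int CARD('n) - int (card S) - 2"
  show ?case
  proof (cases "card S < CARD('n)")
    case False
    then show ?thesis by (intro cycles_bound_negative) auto
  next
    case True
    have sLk: "simplicial_complex ?Lk"
      using simplicial_complex_X less.prems by (intro simplicial_complex_link) auto
    have fin: "finite S" using less.prems by (simp add: unimodular_iff)
    have IH: "acyclic_upto (int CARD('n) - int (card T) - 2) (link X_complex T)"
      if "unimodular T" "card S < card T" for T :: "(int ^ 'n) set"
      using less.hyps[OF _ that(1)] that(2) True by auto
    obtain e g where g: "pairing g e = 1" "\<And>s. s \<in> S \<Longrightarrow> pairing g s = 0"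
      using unimodular_extend[OF less.prems True] by metis
    have level: "cycles_bound ?d (full_subcomplex ?Lk (below g R \<union> F)) ?Lk"
      if "cycles_bound ?d (full_subcomplex ?Lk (below g R)) ?Lk" "R > 0"
        "finite F" "F \<subseteq> {v. \<bar>pairing g v\<bar> = R}" for R F
      using that(3,4)
    proof (induction F rule: finite_induct)
      case empty
      then show ?case using that by simp
    next
      case (insert x F)
      have "cycles_bound ?d (full_subcomplex ?Lk (insert x (below g R \<union> F))) ?Lk"
      proof (rule cycles_bound_insert_vertex[OF sLk])
        show "full_subcomplex ?Lk (insert x (below g R \<union> F)) \<subseteq> ?Lk"
          by (auto simp: full_subcomplex_def)
        show "cycles_bound ?d (full_subcomplex ?Lk (below g R \<union> F)) ?Lk"
          using insert by simp
        show "x \<notin> below g R \<union> F" using insert by (auto simp: below_def)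
        assume "{x} \<in> ?Lk"
        then have x: "x \<notin> S" "unimodular (insert x S)" by (auto simp: mem_link_X)
        then have c: "card (insert x S) = Suc (card S)" using fin by simp
        have "acyclic_upto (int CARD('n) - int (card (insert x S)) - 2)
            (full_subcomplex (link X_complex (insert x S)) (below g R \<union> F))"
          by (rule acyclic_link_below_Un[OF IH, where k = "card S" and w = x])
            (use insert x c that in auto)
        then show "acyclic_upto (?d - 1) (full_subcomplex (link ?Lk {x}) (below g R \<union> F))"
          using x c by (simp add: link_link algebra_simps)
      qed
      then show ?case by simp
    qed
    have below: "cycles_bound ?d (full_subcomplex ?Lk (below g (int (Suc R)))) ?Lk" for R
    proof (induction R)
      case 0
      show ?case
      proof (rule cycles_bound_cone)
        fix U assume "U \<in> full_subcomplex ?Lk (below g (int (Suc 0)))"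
        then have U: "unimodular (S \<union> U)" "S \<inter> U = {}" "\<And>u. u \<in> U \<Longrightarrow> pairing g u = 0"
          by (auto simp: full_subcomplex_def mem_link_X below_def)
        then have "unimodular (insert e (S \<union> U))"
          using g by (intro unimodular_insert[of _ g]) auto
        then show "e \<notin> U \<and> insert e U \<in> ?Lk"
          using U g by (auto simp: mem_link_X)
      qed
    next
      case (Suc R)
      show ?case
      proof (rule cycles_bound_locally_finite)
        fix F assume F: "finite F" "F \<subseteq> below g (int (Suc (Suc R)))"
        let ?F = "F \<inter> {v. \<bar>pairing g v\<bar> = int (Suc R)}"
        have "F \<subseteq> below g (int (Suc R)) \<union> ?F" using F by (auto simp: below_def)
        moreover have "cycles_bound ?d (full_subcomplex ?Lk (below g (int (Suc R)) \<union> ?F)) ?Lk"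
          using level[OF Suc] F by auto
        ultimately show "\<exists>W. F \<subseteq> W \<and> cycles_bound ?d (full_subcomplex ?Lk W) ?Lk" by blast
      qed
    qed
    have "cycles_bound ?d (full_subcomplex ?Lk UNIV) ?Lk"
    proof (rule cycles_bound_locally_finite)
      fix F :: "(int ^ 'n) set" assume F: "finite F"
      have "\<bar>pairing g v\<bar> < int (Suc (\<Sum>u\<in>F. nat \<bar>pairing g u\<bar>))" if "v \<in> F" for v
        using member_le_sum[of v F "\<lambda>u. nat \<bar>pairing g u\<bar>"] F that by linarith
      then have "F \<subseteq> below g (int (Suc (\<Sum>u\<in>F. nat \<bar>pairing g u\<bar>)))" by (auto simp: below_def)
      then show "\<exists>W. F \<subseteq> W \<and> cycles_bound ?d (full_subcomplex ?Lk W) ?Lk" using below by blast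
    qed
    then show ?thesis by (simp add: full_subcomplex_def)
  qed
qed

section \<open>Links of sets of lines\<close>

lemma line_span:
  assumes "unimodular {v}" shows "line (int_vec.span {v})"
  using assms by (simp add: unimodular_def line_def)

text \<open>
  A primitive vector \<open>y\<close> in the direction of a nonzero element lies in \<open>L\<close>, since a direct summand is
  closed under division. If \<open>g y = 1\<close>, any element of \<open>L\<close> minus its \<open>g\<close>-multiple of \<open>y\<close> lies in the
  kernel of \<open>g\<close>, and a nonzero one would be independent of \<open>y\<close>, against rank \<open>1\<close>.
\<close>

lemma line_generator:
  fixes L :: "(int ^ 'n) set"
  assumes L: "line L"
  obtains v where "L = int_vec.span {v}"
proof -
  have sub: "int_vec.subspace L" and rk: "Defs.rank L = 1"
    using L by (auto simp: line_def direct_summand_def)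
  obtain C where C: "int_vec.subspace C" "L \<inter> C = {0}" "{a + b | a b. a \<in> L \<and> b \<in> C} = UNIV"
    using L unfolding line_def direct_summand_def by blast
  obtain B where "finite B" "B \<subseteq> L" "int_vec.independent B" "card B = 1"
    using rank_properties(1)[of L] rk by metis
  then obtain x where x: "x \<in> L" "int_vec.independent {x}"
    by (auto simp: card_1_singleton_iff)
  then have "x \<noteq> 0" using int_vec.dependent_zero[of "{x}"] by auto
  then obtain k y g where y: "x = k *s y" "k \<noteq> 0" "pairing g y = 1"
    by (rule primitive_direction)
  have yL: "y \<in> L"
  proof -
    have "y \<in> {a + b | a b. a \<in> L \<and> b \<in> C}" using C by blast
    then obtain a b where ab: "y = a + b" "a \<in> L" "b \<in> C" by blast
    have "k *s b = x - k *s a" by (simp add: y ab vector_add_ldistrib)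
    then have "k *s b \<in> L" using sub x ab by (simp add: int_vec.subspace_diff int_vec.subspace_scale)
    moreover have "k *s b \<in> C" using C ab by (simp add: int_vec.subspace_scale)
    ultimately have "k *s b = 0" using C by blast
    then have "b = 0" using y(2) by (simp add: vec_eq_iff)
    then show ?thesis using ab by simp
  qed
  have "L \<subseteq> int_vec.span {y}"
  proof
    fix z assume z: "z \<in> L"
    define r where "r = z - pairing g z *s y"
    have rL: "r \<in> L" using sub z yL by (simp add: r_def int_vec.subspace_diff int_vec.subspace_scale)
    have gr: "pairing g r = 0" using y by (simp add: r_def)
    have "r = 0"
    proof (rule ccontr)
      assume "r \<noteq> 0"
      then obtain k' y' h where r: "r = k' *s y'" "k' \<noteq> 0" "pairing h y' = 1"
        by (rule primitive_direction)
      have gy': "pairing g y' = 0" using gr r by simp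
      have "r \<noteq> y" using gr y by auto
      \<comment> \<open>Apply \<open>g\<close> to see that the coefficient of \<open>y\<close> vanishes, and \<open>h\<close> for the coefficient of \<open>r\<close>.\<close>
      have "int_vec.independent {y, r}"
        unfolding int_vec.independent_explicit_module
      proof (intro allI impI)
        fix U u v assume U: "finite U" "U \<subseteq> {y, r}" "(\<Sum>v\<in>U. u v *s v) = 0" "v \<in> U"
        have "(\<Sum>v\<in>U. u v * pairing g v) = 0" "(\<Sum>v\<in>U. u v * pairing h v) = 0"
          using arg_cong[OF U(3), of "pairing g"] arg_cong[OF U(3), of "pairing h"]
          by (simp_all add: pairing_sum_right)
        moreover have "U = {y} \<or> U = {r} \<or> U = {y, r}" using U by auto
        ultimately show "u v = 0"
          using U(4) \<open>r \<noteq> y\<close> y(3) gr r by auto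
      qed
      then have "card {y, r} \<le> Defs.rank L"
        using rank_properties(2)[of "{y, r}" L] yL rL by auto
      then show False using rk \<open>r \<noteq> y\<close> by simp
    qed
    then have "z = pairing g z *s y" by (simp add: r_def)
    then show "z \<in> int_vec.span {y}"
      by (metis int_vec.span_base int_vec.span_scale singletonI)
  qed
  moreover have "int_vec.span {y} \<subseteq> L"
    using sub yL by (intro int_vec.span_minimal) auto
  ultimately show ?thesis using that by blast
qed

text \<open>
  One of the two generators of a line; any choice defines a section of the map that sends a
  primitive vector to its span.
\<close>

definition generator :: "(int ^ 'n) set \<Rightarrow> int ^ 'n" where
  "generator L = (SOME v. L = int_vec.span {v})"

lemma span_generator: "line L \<Longrightarrow> int_vec.span {generator L} = L"
  unfolding generator_def by (metis (mono_tags, lifting) line_generator someI_ex)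

lemma inj_on_generator: "\<forall>L\<in>S. line L \<Longrightarrow> inj_on generator S"
  by (metis inj_onI span_generator)

lemma span_Union_span_singletons:
  "int_vec.span (\<Union>v\<in>T. int_vec.span {v}) = int_vec.span T"
proof (rule int_vec.span_eq[THEN iffD2], intro conjI)
  show "(\<Union>v\<in>T. int_vec.span {v}) \<subseteq> int_vec.span T"
    using int_vec.span_mono by (metis UN_least empty_subsetI insert_subset)
  show "T \<subseteq> int_vec.span (\<Union>v\<in>T. int_vec.span {v})"
    by (auto intro!: int_vec.span_base)
qed

lemma inj_on_span_singleton:
  assumes "unimodular T" shows "inj_on (\<lambda>v. int_vec.span {v}) T"
proof (rule inj_onI, rule ccontr)
  fix v w assume vw: "v \<in> T" "w \<in> T" "int_vec.span {v} = int_vec.span {w}" "v \<noteq> w"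
  obtain d where d: "pairing d v = 1" "pairing d w = 0"
    using assms vw unfolding unimodular_iff has_dual_system_def by (metis Diff_iff singletonD)
  have "v \<in> int_vec.span {w}" using vw int_vec.span_base[of v "{v}"] by simp
  then obtain k where "v = k *s w" by (auto simp: int_vec.span_singleton)
  then show False using d by simp
qed

lemma span_singletons_mem_K:
  assumes T: "unimodular T" shows "(\<lambda>v. int_vec.span {v}) ` T \<in> K_complex"
proof -
  have "line (int_vec.span {v})" if "v \<in> T" for v
    using that T by (intro line_span) (auto intro: unimodular_subset)
  then show ?thesis
    using T by (auto simp: K_complex_def unimodular_def span_Union_span_singletons
        card_image inj_on_span_singleton)
qed

lemma mem_K_complex_iff:
  "S \<in> K_complex \<longleftrightarrow> finite S \<and> (\<forall>L\<in>S. line L) \<and> unimodular (generator ` S)"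
proof (cases "finite S \<and> (\<forall>L\<in>S. line L)")
  case True
  have "\<Union>S = (\<Union>v\<in>generator ` S. int_vec.span {v})"
    using True by (auto simp: span_generator)
  then have "int_vec.span (\<Union>S) = int_vec.span (generator ` S)"
    by (simp only: span_Union_span_singletons)
  then show ?thesis
    using True by (simp add: K_complex_def unimodular_def card_image inj_on_generator)
qed (auto simp: K_complex_def)

lemma simplicial_complex_K: "simplicial_complex (K_complex :: (int ^ 'n) set set set)"
  unfolding simplicial_complex_def
proof (intro conjI ballI allI impI)
  show "{} \<in> K_complex" by (simp add: mem_K_complex_iff)
  fix S T :: "(int ^ 'n) set set" assume S: "S \<in> K_complex"
  then show "finite S" by (simp add: mem_K_complex_iff)
  assume "T \<subseteq> S"
  then show "T \<in> K_complex"
    using S by (auto simp: mem_K_complex_iff intro: finite_subset unimodular_subset[of "generator ` S"])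
qed

text \<open>
  Choosing generators embeds the link of \<open>S\<close> in the link of the set of its generators, and taking
  spans maps back; so the links for lines are retracts of the links for vectors.
\<close>

lemma acyclic_link_K:
  fixes S :: "(int ^ 'n) set set"
  assumes S: "S \<in> K_complex"
  shows "acyclic_upto (int CARD('n) - int (card S) - 2) (link K_complex S)"
proof -
  let ?T = "generator ` S" and ?r = "\<lambda>v. int_vec.span {v}"
  have T: "unimodular ?T" and lines: "\<forall>L\<in>S. line L" using S by (auto simp: mem_K_complex_iff)
  have rT: "?r ` ?T = S" using lines by (force simp: span_generator)
  have "card ?T = card S" using lines by (simp add: card_image inj_on_generator)
  then have ac: "acyclic_upto (int CARD('n) - int (card S) - 2) (link X_complex ?T)"
    using acyclic_link_X[OF T] by simp
  show ?thesis
  proof (rule acyclic_upto_retract[OF ac])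
    show "simplicial_embedding generator (link K_complex S) (link X_complex ?T)"
      unfolding simplicial_embedding_def
    proof
      fix U assume "U \<in> link K_complex S"
      then have U: "S \<union> U \<in> K_complex" "S \<inter> U = {}" by (auto simp: link_def)
      then have "\<forall>L\<in>S \<union> U. line L" "unimodular (?T \<union> generator ` U)"
        by (auto simp: mem_K_complex_iff image_Un)
      moreover from this have inj: "inj_on generator (S \<union> U)" by (intro inj_on_generator)
      ultimately show "inj_on generator U \<and> generator ` U \<in> link X_complex ?T"
        using inj_on_image_Int[OF inj, of S U] U(2) by (auto simp: mem_link_X inj_on_Un)
    qed
    show "simplicial_embedding ?r (link X_complex ?T) (link K_complex S)"
      unfolding simplicial_embedding_def
    proof
      fix U assume "U \<in> link X_complex ?T"
      then have U: "unimodular (?T \<union> U)" "?T \<inter> U = {}" by (auto simp: mem_link_X)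
      have inj: "inj_on ?r (?T \<union> U)" by (rule inj_on_span_singleton[OF U(1)])
      have "?r ` (?T \<union> U) = S \<union> ?r ` U" by (simp only: image_Un rT)
      moreover have "S \<inter> ?r ` U = {}"
        using inj_on_image_Int[OF inj, of ?T U] U(2) rT by simp
      ultimately show "inj_on ?r U \<and> ?r ` U \<in> link K_complex S"
        using span_singletons_mem_K[OF U(1)] inj by (auto simp: link_def inj_on_Un)
    qed
    show "?r (generator L) = L" if "L \<in> \<Union> (link K_complex S)" for L
      by (rule span_generator) (use that in \<open>auto simp: link_def mem_K_complex_iff\<close>)
  qed
qed

section \<open>The Cohen-Macaulay property\<close>

theorem corollary1p4:
  shows "cohen_macaulay (X_complex :: (int ^ 'n::finite) set set) \<and>
         cohen_macaulay (K_complex :: (int ^ 'n::finite) set set set)"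
proof
  show "cohen_macaulay (X_complex :: (int ^ 'n) set set)"
    by (rule cohen_macaulayI[OF simplicial_complex_X, where n = "CARD('n)"])
      (auto intro: unimodular_card_le acyclic_link_X)
  show "cohen_macaulay (K_complex :: (int ^ 'n) set set set)"
  proof (rule cohen_macaulayI[OF simplicial_complex_K, where n = "CARD('n)"])
    show "card S \<le> CARD('n)" if "S \<in> K_complex" for S :: "(int ^ 'n) set set"
      using that unimodular_card_le[of "generator ` S"]
      by (auto simp: mem_K_complex_iff card_image inj_on_generator)
  qed (rule acyclic_link_K)
qed

end
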